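(* Let $\mathcal{C}$ be a finite set of great circles on the unit sphere $S^2\subset\mathbb{R}^3$ such that the closures of the connected components of $S^2\setminus\bigcup_{C\in\mathcal{C}}C$ are spherical triangles, all congruent to one another. Then for every vertex $v$ (a point lying on at least two circles of $\mathcal{C}$), all the angles at $v$ of the triangles incident to $v$ are equal.
   Context: Two spherical triangles are congruent if one is the image of the other under an isometry of $S^2$. *)

theory Defs
  imports "HOL-Analysis.Analysis"
begin

definition great_circle :: "(real ^ 3) set \<Rightarrow> bool" where
  "great_circle C \<longleftrightarrow> (\<exists>n. n \<noteq> 0 \<and> C = {x \<in> sphere 0 1. n \<bullet> x = 0})"

(* The closed regions cut out by the circles; the closure in R^3 agrees with the closure in
   the sphere because the sphere is closed. *)
definition cells :: "(real ^ 3) set set \<Rightarrow> (real ^ 3) set set" where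
  "cells \<C> = closure ` components (sphere 0 1 - \<Union>\<C>)"

(* The dimension condition says that the points do not lie on a common great circle. *)
definition triangle_corners :: "real ^ 3 \<Rightarrow> real ^ 3 \<Rightarrow> real ^ 3 \<Rightarrow> bool" where
  "triangle_corners a b c \<longleftrightarrow> {a, b, c} \<subseteq> sphere 0 1 \<and> dim {a, b, c} = 3"

(* The central projection to the sphere of the Euclidean triangle abc. *)
definition triangle_region :: "real ^ 3 \<Rightarrow> real ^ 3 \<Rightarrow> real ^ 3 \<Rightarrow> (real ^ 3) set" where
  "triangle_region a b c = {x \<in> sphere 0 1. \<exists>s t u. s \<ge> 0 \<and> t \<ge> 0 \<and> u \<ge> 0 \<and>
      x = s *\<^sub>R a + t *\<^sub>R b + u *\<^sub>R c}"

definition spherical_triangle :: "(real ^ 3) set \<Rightarrow> bool" where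
  "spherical_triangle T \<longleftrightarrow> (\<exists>a b c. triangle_corners a b c \<and> T = triangle_region a b c)"

definition sphere_dist :: "real ^ 3 \<Rightarrow> real ^ 3 \<Rightarrow> real" where
  "sphere_dist x y = arccos (x \<bullet> y)"

definition sphere_isometry :: "(real ^ 3 \<Rightarrow> real ^ 3) \<Rightarrow> bool" where
  "sphere_isometry f \<longleftrightarrow> bij_betw f (sphere 0 1) (sphere 0 1) \<and>
     (\<forall>x \<in> sphere 0 1. \<forall>y \<in> sphere 0 1. sphere_dist (f x) (f y) = sphere_dist x y)"

definition sphere_congruent :: "(real ^ 3) set \<Rightarrow> (real ^ 3) set \<Rightarrow> bool" where
  "sphere_congruent S T \<longleftrightarrow> (\<exists>f. sphere_isometry f \<and> f ` S = T)"

(* For unit vectors v and x with x distinct from v and -v, this is a positive multiple of the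
   initial direction at v of the great-circle arc from v to x. *)
definition tangent_part :: "real ^ 3 \<Rightarrow> real ^ 3 \<Rightarrow> real ^ 3" where
  "tangent_part v x = x - (v \<bullet> x) *\<^sub>R v"

definition corner_angle :: "real ^ 3 \<Rightarrow> real ^ 3 \<Rightarrow> real ^ 3 \<Rightarrow> real" where
  "corner_angle v b c = arccos ((tangent_part v b \<bullet> tangent_part v c) /
     (norm (tangent_part v b) * norm (tangent_part v c)))"

(* The corners b and c are not unique as an ordered pair, but the angle is: has_angle_at_unique. *)
definition has_angle_at :: "(real ^ 3) set \<Rightarrow> real ^ 3 \<Rightarrow> real \<Rightarrow> bool" where
  "has_angle_at T v \<alpha> \<longleftrightarrow> (\<exists>b c. triangle_corners v b c \<and> T = triangle_region v b c \<and>
      \<alpha> = corner_angle v b c)"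

lemma dim3_indep:
  fixes a b c :: "real ^ 3"
  assumes "dim {a, b, c} = 3" "s *\<^sub>R a + t *\<^sub>R b + u *\<^sub>R c = 0"
  shows "s = 0" "t = 0" "u = 0"
proof -
  have key: "s = 0" if d: "dim {a, b, c} = 3" and e: "s *\<^sub>R a + t *\<^sub>R b + u *\<^sub>R c = 0"
    for a b c :: "real ^ 3" and s t u
  proof (rule ccontr)
    assume s: "s \<noteq> 0"
    have "s *\<^sub>R a = (- t) *\<^sub>R b + (- u) *\<^sub>R c"
      using e by (simp add: algebra_simps eq_neg_iff_add_eq_0)
    then have "(1 / s) *\<^sub>R (s *\<^sub>R a) = (1 / s) *\<^sub>R ((- t) *\<^sub>R b + (- u) *\<^sub>R c)" by simp
    then have "a = (1 / s) *\<^sub>R ((- t) *\<^sub>R b + (- u) *\<^sub>R c)" using s by simp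
    moreover have "(1 / s) *\<^sub>R ((- t) *\<^sub>R b + (- u) *\<^sub>R c) \<in> span {b, c}"
      by (intro span_scale span_add span_base) auto
    ultimately have "a \<in> span {b, c}" by simp
    then have "dim {a, b, c} = dim {b, c}" by (simp add: dim_insert)
    also have "\<dots> \<le> card {b, c}" by (rule dim_le_card') simp
    also have "\<dots> \<le> 2" by (simp add: card_insert_if)
    finally show False using d by simp
  qed
  show "s = 0" using key assms by blast
  have "dim {b, a, c} = 3" "t *\<^sub>R b + s *\<^sub>R a + u *\<^sub>R c = 0"
    using assms by (simp_all add: insert_commute add_ac)
  then show "t = 0" using key by blast
  have "dim {c, a, b} = 3" "u *\<^sub>R c + s *\<^sub>R a + t *\<^sub>R b = 0"
    using assms by (simp_all add: insert_commute add_ac)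
  then show "u = 0" using key by blast
qed

lemma corner_angle_commute: "corner_angle v b c = corner_angle v c b"
  by (simp add: corner_angle_def inner_commute mult.commute)

lemma corner_angle_scale:
  assumes "tangent_part v b' = s *\<^sub>R tangent_part v b" "tangent_part v c' = t *\<^sub>R tangent_part v c"
    "s > 0" "t > 0"
  shows "corner_angle v b' c' = corner_angle v b c"
  using assms by (simp add: corner_angle_def)

lemma has_angle_at_unique:
  assumes "has_angle_at T v \<alpha>" "has_angle_at T v \<beta>"
  shows "\<alpha> = \<beta>"
proof -
  obtain b c where bc: "triangle_corners v b c" "T = triangle_region v b c" "\<alpha> = corner_angle v b c"
    using assms(1) unfolding has_angle_at_def by blast
  obtain b' c' where bc': "triangle_corners v b' c'" "T = triangle_region v b' c'"
      "\<beta> = corner_angle v b' c'"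
    using assms(2) unfolding has_angle_at_def by blast
  have vv: "v \<bullet> v = 1"
    using bc(1) by (simp add: triangle_corners_def dot_square_norm)
  have corners: "x \<in> triangle_region v x y" "y \<in> triangle_region v x y"
    if "triangle_corners v x y" for x y
  proof -
    have *: "x \<in> sphere 0 1" "y \<in> sphere 0 1"
      using that unfolding triangle_corners_def by auto
    have "x = 0 *\<^sub>R v + 1 *\<^sub>R x + 0 *\<^sub>R y" by simp
    then have "\<exists>s t u. s \<ge> 0 \<and> t \<ge> 0 \<and> u \<ge> 0 \<and> x = s *\<^sub>R v + t *\<^sub>R x + u *\<^sub>R y"
      by (metis order_refl zero_le_one)
    then show "x \<in> triangle_region v x y"
      using * unfolding triangle_region_def by blast
    have "y = 0 *\<^sub>R v + 0 *\<^sub>R x + 1 *\<^sub>R y" by simp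
    then have "\<exists>s t u. s \<ge> 0 \<and> t \<ge> 0 \<and> u \<ge> 0 \<and> y = s *\<^sub>R v + t *\<^sub>R x + u *\<^sub>R y"
      by (metis order_refl zero_le_one)
    then show "y \<in> triangle_region v x y"
      using * unfolding triangle_region_def by blast
  qed
  have tp: "\<exists>t u. t \<ge> 0 \<and> u \<ge> 0 \<and> tangent_part v z = t *\<^sub>R tangent_part v x + u *\<^sub>R tangent_part v y"
    if zT: "z \<in> triangle_region v x y" for x y z
  proof -
    obtain s t u where "t \<ge> 0" "u \<ge> 0" and z: "z = s *\<^sub>R v + t *\<^sub>R x + u *\<^sub>R y"
      using zT unfolding triangle_region_def by blast
    moreover have "tangent_part v z = t *\<^sub>R tangent_part v x + u *\<^sub>R tangent_part v y"
    proof -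
      have "v \<bullet> z = s + t * (v \<bullet> x) + u * (v \<bullet> y)"
        unfolding z by (simp only: inner_add_right inner_scaleR_right vv mult_1_right)
      then show ?thesis
        unfolding tangent_part_def by (subst (1) z) (simp add: scaleR_add_left scaleR_diff_right)
    qed
    ultimately show ?thesis by blast
  qed
  define B C B' C' where BC: "B = tangent_part v b" "C = tangent_part v c"
    "B' = tangent_part v b'" "C' = tangent_part v c'"
  have ind: "x = 0 \<and> y = 0" if "x *\<^sub>R B + y *\<^sub>R C = 0" for x y
  proof -
    have "(- x * (v \<bullet> b) - y * (v \<bullet> c)) *\<^sub>R v + x *\<^sub>R b + y *\<^sub>R c = 0"
      using that unfolding BC tangent_part_def by (simp add: algebra_simps)
    note * = this
    have "dim {v, b, c} = 3" using bc(1) unfolding triangle_corners_def by blast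
    from dim3_indep(2)[OF this *] dim3_indep(3)[OF this *] show ?thesis ..
  qed
  obtain t u where 1: "t \<ge> 0" "u \<ge> 0" "B' = t *\<^sub>R B + u *\<^sub>R C"
    using tp[of b' b c] corners(1)[OF bc'(1), folded bc'(2), unfolded bc(2)] unfolding BC by blast
  obtain t2 u2 where 2: "t2 \<ge> 0" "u2 \<ge> 0" "C' = t2 *\<^sub>R B + u2 *\<^sub>R C"
    using tp[of c' b c] corners(2)[OF bc'(1), folded bc'(2), unfolded bc(2)] unfolding BC by blast
  obtain q r where 3: "q \<ge> 0" "r \<ge> 0" "B = q *\<^sub>R B' + r *\<^sub>R C'"
    using tp[of b b' c'] corners(1)[OF bc(1), folded bc(2), unfolded bc'(2)] unfolding BC by blast
  obtain q2 r2 where 4: "q2 \<ge> 0" "r2 \<ge> 0" "C = q2 *\<^sub>R B' + r2 *\<^sub>R C'"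
    using tp[of c b' c'] corners(2)[OF bc(1), folded bc(2), unfolded bc'(2)] unfolding BC by blast
  have "(q * t + r * t2 - 1) *\<^sub>R B + (q * u + r * u2) *\<^sub>R C = (q *\<^sub>R B' + r *\<^sub>R C') - B"
    unfolding 1(3) 2(3) by (simp add: algebra_simps)
  then have e1: "q * t + r * t2 = 1" "q * u + r * u2 = 0" using ind[of "q * t + r * t2 - 1" "q * u + r * u2"] 3(3)[symmetric] by simp_all
  have "(q2 * t + r2 * t2) *\<^sub>R B + (q2 * u + r2 * u2 - 1) *\<^sub>R C = (q2 *\<^sub>R B' + r2 *\<^sub>R C') - C"
    unfolding 1(3) 2(3) by (simp add: algebra_simps)
  then have e2: "q2 * t + r2 * t2 = 0" "q2 * u + r2 * u2 = 1" using ind[of "q2 * t + r2 * t2" "q2 * u + r2 * u2 - 1"] 4(3)[symmetric] by simp_all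
  have z: "q * u = 0" "r * u2 = 0" "q2 * t = 0" "r2 * t2 = 0"
    using e1(2) e2(1) 1(1,2) 2(1,2) 3(1,2) 4(1,2)
    by (simp_all add: add_nonneg_eq_0_iff)
  show ?thesis
  proof (cases "q = 0")
    case False
    then have "u = 0" using z by simp
    then have "r2 \<noteq> 0" "u2 \<noteq> 0" using e2 by auto
    then have "t2 = 0" using z by simp
    then have "t \<noteq> 0" using e1 by auto
    have "corner_angle v b' c' = corner_angle v b c"
    proof (rule corner_angle_scale)
      show "tangent_part v b' = t *\<^sub>R tangent_part v b" "tangent_part v c' = u2 *\<^sub>R tangent_part v c"
        using 1(3) 2(3) \<open>u = 0\<close> \<open>t2 = 0\<close> unfolding BC by simp_all
    qed (use 1 2 \<open>t \<noteq> 0\<close> \<open>u2 \<noteq> 0\<close> in linarith)+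
    then show ?thesis using bc(3) bc'(3) by simp
  next
    case True
    then have "r \<noteq> 0" "t2 \<noteq> 0" using e1 by auto
    then have "u2 = 0" using z by simp
    then have "q2 \<noteq> 0" "u \<noteq> 0" using e2 by auto
    then have "t = 0" using z by simp
    have "corner_angle v b' c' = corner_angle v c b"
    proof (rule corner_angle_scale)
      show "tangent_part v b' = u *\<^sub>R tangent_part v c" "tangent_part v c' = t2 *\<^sub>R tangent_part v b"
        using 1(3) 2(3) \<open>t = 0\<close> \<open>u2 = 0\<close> unfolding BC by simp_all
    qed (use 1 2 \<open>t2 \<noteq> 0\<close> \<open>u \<noteq> 0\<close> in linarith)+
    then show ?thesis using bc(3) bc'(3) corner_angle_commute[of v c b] by simp
  qed
qed

end

theory Submission
  imports Defs
begin

text \<open>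
  The argument is local. Record the triangle by the three cosines of its sides. Half a turn around
  a vertex consists of finitely many sectors whose angles add up to \<open>\<pi>\<close>; consecutive sectors share
  a side, and opposite sectors have equal angles. If the angles at the vertex are not all
  equal, then the sides leaving the vertex also repeat after half a turn, and counting the
  occurrences of a given side length on both sides of each edge shows that the number of sectors
  with a given angle has the parity of the number of sectors, times the multiplicity of the
  corresponding side in the triangle. Since the angles of the triangle add up to more than \<open>\<pi>\<close>, the
  triangle must be scalene and every angle that occurs must occur at least twice. Hence every angle
  of the triangle is at most \<open>\<pi> / 2\<close>, and at a vertex with two different angles \<open>\<alpha>\<close>, \<open>\<beta>\<close> we get
  \<open>2 \<alpha> + 2 \<beta> \<le> \<pi>\<close>, so the third angle would exceed \<open>\<pi> / 2\<close>.
\<close>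

section \<open>Spherical trigonometry\<close>

text \<open>The spherical law of cosines solved for an angle: \<open>M\<close> holds the cosines of
  the three sides, \<open>y\<close> that of the opposite side. Treating the other two as what
  remains of a multiset makes their order irrelevant.\<close>

definition opposite_angle :: "real multiset \<Rightarrow> real \<Rightarrow> real" where
  "opposite_angle M y = arccos ((y - prod_mset (M - {#y#})) /
     sqrt (\<Prod>z\<in>#M - {#y#}. 1 - z\<^sup>2))"

lemma opposite_angle_triple:
  "opposite_angle {#x, x', y#} y = arccos ((y - x * x') / (sqrt (1 - x\<^sup>2) * sqrt (1 - x'\<^sup>2)))"
proof -
  have "{#x, x', y#} - {#y#} = {#x, x'#}"
    by (metis add_mset_commute add_mset_remove_trivial)
  then show ?thesis by (simp add: opposite_angle_def real_sqrt_mult)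
qed

text \<open>\<open>D\<close> is the Gram determinant of three unit vectors with inner products
  \<open>A\<close>, \<open>B\<close>, \<open>C\<close>. With \<open>q\<close> the common
  denominator, q^2 - (A - B * C)^2 = D gives the sine, and \<open>D > 0\<close> keeps the cosine
  strictly between -1 and 1.\<close>

lemma gram_det_trig:
  fixes A B C :: real
  assumes "\<bar>A\<bar> < 1" "\<bar>B\<bar> < 1" "\<bar>C\<bar> < 1"
    and D: "D = 1 - A\<^sup>2 - B\<^sup>2 - C\<^sup>2 + 2 * A * B * C" "D > 0"
    and \<alpha>: "\<alpha> = arccos ((A - B * C) / (sqrt (1 - B\<^sup>2) * sqrt (1 - C\<^sup>2)))"
  shows "cos \<alpha> = (A - B * C) / (sqrt (1 - B\<^sup>2) * sqrt (1 - C\<^sup>2))"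
    and "sin \<alpha> = sqrt D / (sqrt (1 - B\<^sup>2) * sqrt (1 - C\<^sup>2))"
    and "0 < \<alpha>" and "\<alpha> < pi"
proof -
  define q where "q = sqrt (1 - B\<^sup>2) * sqrt (1 - C\<^sup>2)"
  have B: "B\<^sup>2 < 1" and C: "C\<^sup>2 < 1" using assms by (simp_all add: abs_square_less_1)
  have q: "q > 0" using B C by (simp add: q_def)
  have q2: "q\<^sup>2 = (1 - B\<^sup>2) * (1 - C\<^sup>2)" using B C by (simp add: q_def power_mult_distrib)
  have *: "q\<^sup>2 - (A - B * C)\<^sup>2 = D" unfolding q2 D by (simp add: power2_eq_square algebra_simps)
  have eq: "1 - ((A - B * C) / q)\<^sup>2 = D / q\<^sup>2"
    unfolding *[symmetric] power_divide diff_divide_distrib[of "q\<^sup>2"] using q by simp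
  moreover have "D / q\<^sup>2 > 0" using q D(2) by simp
  ultimately have "((A - B * C) / q)\<^sup>2 < 1" by linarith
  then have ab: "\<bar>(A - B * C) / q\<bar> < 1" by (simp add: abs_square_less_1)
  show "cos \<alpha> = (A - B * C) / (sqrt (1 - B\<^sup>2) * sqrt (1 - C\<^sup>2))"
    unfolding \<alpha> using ab unfolding q_def by (intro cos_arccos) linarith+
  have "sin \<alpha> = sqrt (1 - ((A - B * C) / q)\<^sup>2)"
    unfolding \<alpha> using ab unfolding q_def by (intro sin_arccos) linarith+
  also have "\<dots> = sqrt D / q" unfolding eq using q by (simp add: real_sqrt_divide)
  finally show "sin \<alpha> = sqrt D / (sqrt (1 - B\<^sup>2) * sqrt (1 - C\<^sup>2))" unfolding q_def .
  have "0 < \<alpha> \<and> \<alpha> < pi"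
    unfolding \<alpha> using ab unfolding q_def by (intro arccos_lt_bounded) linarith+
  then show "0 < \<alpha>" "\<alpha> < pi" by simp_all
qed

text \<open>The addition formula turns cos \<alpha> + cos (\<beta> + \<gamma>) into -(1 - A) * D
  over a positive number, so cos \<alpha> < cos (pi - (\<beta> + \<gamma>)); cosine decreases on
  [0, pi].\<close>

lemma angle_sum_gt_pi:
  fixes A B C :: real
  assumes A: "\<bar>A\<bar> < 1" and B: "\<bar>B\<bar> < 1" and C: "\<bar>C\<bar> < 1"
    and D: "1 - A\<^sup>2 - B\<^sup>2 - C\<^sup>2 + 2 * A * B * C > 0"
  shows "arccos ((A - B * C) / (sqrt (1 - B\<^sup>2) * sqrt (1 - C\<^sup>2)))
    + arccos ((B - A * C) / (sqrt (1 - A\<^sup>2) * sqrt (1 - C\<^sup>2)))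
    + arccos ((C - A * B) / (sqrt (1 - A\<^sup>2) * sqrt (1 - B\<^sup>2))) > pi"
proof -
  define \<alpha> where "\<alpha> = arccos ((A - B * C) / (sqrt (1 - B\<^sup>2) * sqrt (1 - C\<^sup>2)))"
  define \<beta> where "\<beta> = arccos ((B - A * C) / (sqrt (1 - A\<^sup>2) * sqrt (1 - C\<^sup>2)))"
  define \<gamma> where "\<gamma> = arccos ((C - A * B) / (sqrt (1 - A\<^sup>2) * sqrt (1 - B\<^sup>2)))"
  define D where "D = 1 - A\<^sup>2 - B\<^sup>2 - C\<^sup>2 + 2 * A * B * C"
  have Dp: "D > 0" using D by (simp add: D_def)
  note a = gram_det_trig[OF A B C D_def Dp \<alpha>_def]
  have b: "cos \<beta> = (B - A * C) / (sqrt (1 - A\<^sup>2) * sqrt (1 - C\<^sup>2))"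
     "sin \<beta> = sqrt D / (sqrt (1 - A\<^sup>2) * sqrt (1 - C\<^sup>2))" "0 < \<beta>" "\<beta> < pi"
    by (rule gram_det_trig[OF B A C _ Dp \<beta>_def]; simp add: D_def algebra_simps)+
  have c: "cos \<gamma> = (C - A * B) / (sqrt (1 - A\<^sup>2) * sqrt (1 - B\<^sup>2))"
     "sin \<gamma> = sqrt D / (sqrt (1 - A\<^sup>2) * sqrt (1 - B\<^sup>2))" "0 < \<gamma>" "\<gamma> < pi"
    by (rule gram_det_trig[OF C A B _ Dp \<gamma>_def]; simp add: D_def algebra_simps)+
  define p q r where "p = sqrt (1 - A\<^sup>2)" "q = sqrt (1 - B\<^sup>2)" "r = sqrt (1 - C\<^sup>2)"
  note pqr = this
  have pos: "p > 0" "q > 0" "r > 0" using A B C by (simp_all add: pqr abs_square_less_1)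
  have p2: "p\<^sup>2 = 1 - A\<^sup>2" using A by (simp add: pqr abs_square_le_1)
  have D2: "sqrt D * sqrt D = D" using Dp by simp
  have "cos (\<beta> + \<gamma>) = ((B - A * C) * (C - A * B) - D) / (p\<^sup>2 * q * r)"
    unfolding cos_add b c pqr[symmetric] times_divide_times_eq D2
      diff_divide_distrib[of "(B - A * C) * (C - A * B)" D]
    by (simp only: power2_eq_square mult_ac)
  then have "cos \<alpha> + cos (\<beta> + \<gamma>)
      = (A - B * C) / (q * r) + ((B - A * C) * (C - A * B) - D) / (p\<^sup>2 * q * r)"
    unfolding a pqr[symmetric] by simp
  also have "\<dots> = ((A - B * C) * p\<^sup>2 + ((B - A * C) * (C - A * B) - D)) / (p\<^sup>2 * q * r)"
    using pos by (simp add: add_divide_distrib)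
  also have "(A - B * C) * p\<^sup>2 + ((B - A * C) * (C - A * B) - D) = - ((1 - A) * D)"
    unfolding p2 D_def by (simp add: power2_eq_square algebra_simps)
  also have "\<dots> / (p\<^sup>2 * q * r) < 0"
    using pos Dp A by (simp add: divide_neg_pos)
  finally have lt: "cos \<alpha> < cos (pi - (\<beta> + \<gamma>))" by (simp add: cos_diff)
  have "\<alpha> + \<beta> + \<gamma> > pi"
  proof (cases "\<beta> + \<gamma> < pi")
    case True
    then have "pi - (\<beta> + \<gamma>) < \<alpha>"
      using lt cos_mono_less_eq[of "pi - (\<beta> + \<gamma>)" \<alpha>] a b c cos_mono_le_eq[of "pi - (\<beta> + \<gamma>)" \<alpha>]
      by (simp add: not_le)
    then show ?thesis by simp
  next
    case False then show ?thesis using a by simp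
  qed
  then show ?thesis by (simp add: \<alpha>_def \<beta>_def \<gamma>_def)
qed

text \<open>Squaring the equality of the two cosines factors it as (A^2 - B^2) * D = 0 with
  \<open>D\<close> the positive Gram determinant.\<close>

lemma opposite_angle_inj:
  fixes A B C :: real
  assumes A: "\<bar>A\<bar> < 1" and B: "\<bar>B\<bar> < 1" and C: "\<bar>C\<bar> < 1"
    and D: "1 - A\<^sup>2 - B\<^sup>2 - C\<^sup>2 + 2 * A * B * C > 0"
    and eq: "opposite_angle {#B, C, A#} A = opposite_angle {#A, C, B#} B"
  shows "A = B"
proof -
  define \<alpha> where "\<alpha> = arccos ((A - B * C) / (sqrt (1 - B\<^sup>2) * sqrt (1 - C\<^sup>2)))"
  define \<beta> where "\<beta> = arccos ((B - A * C) / (sqrt (1 - A\<^sup>2) * sqrt (1 - C\<^sup>2)))"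
  define D where "D = 1 - A\<^sup>2 - B\<^sup>2 - C\<^sup>2 + 2 * A * B * C"
  have Dp: "D > 0" using D by (simp add: D_def)
  have ca: "cos \<alpha> = (A - B * C) / (sqrt (1 - B\<^sup>2) * sqrt (1 - C\<^sup>2))"
    by (rule gram_det_trig[OF A B C D_def Dp \<alpha>_def])
  have cb: "cos \<beta> = (B - A * C) / (sqrt (1 - A\<^sup>2) * sqrt (1 - C\<^sup>2))"
    by (rule gram_det_trig[OF B A C _ Dp \<beta>_def]; simp add: D_def algebra_simps)
  have "\<alpha> = \<beta>" using eq by (simp add: opposite_angle_triple \<alpha>_def \<beta>_def)
  define p q r where "p = sqrt (1 - A\<^sup>2)" "q = sqrt (1 - B\<^sup>2)" "r = sqrt (1 - C\<^sup>2)"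
  note pqr = this
  have pos: "p > 0" "q > 0" "r > 0" using A B C by (simp_all add: pqr abs_square_less_1)
  have p2: "p\<^sup>2 = 1 - A\<^sup>2" "q\<^sup>2 = 1 - B\<^sup>2" using A B by (simp_all add: pqr abs_square_le_1)
  have *: "(A - B * C) * p = (B - A * C) * q"
  proof -
    have "(A - B * C) / (q * r) = (B - A * C) / (p * r)"
      using ca cb \<open>\<alpha> = \<beta>\<close> unfolding pqr[symmetric] by simp
    then have "(A - B * C) * (p * r) = (B - A * C) * (q * r)"
      using pos by (subst (asm) frac_eq_eq) simp_all
    then have "((A - B * C) * p) * r = ((B - A * C) * q) * r" by (simp only: mult.assoc)
    then show ?thesis using pos by simp
  qed
  then have "(A - B * C)\<^sup>2 * p\<^sup>2 = (B - A * C)\<^sup>2 * q\<^sup>2" by (metis power_mult_distrib)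
  then have "(A\<^sup>2 - B\<^sup>2) * D = 0"
    unfolding p2 D_def by (simp add: power2_eq_square algebra_simps)
  then have "A\<^sup>2 = B\<^sup>2" using Dp by simp
  then consider "A = B" | "A = - B" by (auto simp: power2_eq_iff)
  then show ?thesis
  proof cases
    \<comment> \<open>Squaring lost the sign: for \<open>A = - B\<close> the unsquared equation
      leaves B * (1 + C) = 0, hence both are 0.\<close>
    case 2
    then have "p = q" by (simp add: pqr)
    then have "A - B * C = B - A * C" using * pos by simp
    then have "B * (1 + C) = 0" using 2 by (simp add: algebra_simps)
    then show ?thesis using C 2 by auto
  qed
qed

section \<open>Angle patterns around a vertex\<close>

text \<open>The combinatorics around a vertex: \<open>x i\<close> is the cosine of the length of the \<open>i\<close>-th side
  leaving the vertex, \<open>y i\<close> that of the side opposite to the vertex in the \<open>i\<close>-th sector, and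
  \<open>g\<close> maps the cosine of a side to its opposite angle; \<open>n\<close> sectors make up half a turn.\<close>

locale triangle_pattern =
  fixes M :: "real multiset" and g :: "real \<Rightarrow> real" and n :: nat and x y :: "nat \<Rightarrow> real"
  assumes g_pos: "\<And>z. z \<in># M \<Longrightarrow> g z > 0"
    and g_sum: "(\<Sum>z\<in>#M. g z) > pi"
    and n_ge_2: "2 \<le> n"
    and triple: "\<And>i. {#x i, x (Suc i), y i#} = M"
    and y_periodic: "\<And>i. y (i + n) = y i"
    and half_turn: "(\<Sum>i<n. g (y i)) = pi"
begin

definition steps :: "real \<Rightarrow> nat" where
  "steps z = card {i. i < n \<and> y i = z}"

lemma y_in_M: "y i \<in># M"
  using triple[of i] by (metis union_single_eq_member add_mset_commute)

lemma y_mod: "y (i mod n) = y i"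
proof -
  have "y (i + k * n) = y i" for i k
    by (induction k) (use y_periodic[of "i + k * n" for k] in \<open>simp_all add: add_ac\<close>)
  from this[of "i mod n" "i div n"] show ?thesis by simp
qed

lemma sum_triple: "x i + x (Suc i) + y i = sum_mset M"
  using triple[of i] by (metis (no_types) sum_mset.add_mset sum_mset.empty add.assoc add.right_neutral)

text \<open>Cancelling the shared side \<open>x (Suc i)\<close> from two consecutive triples leaves
  two equal pairs. As their \<open>y\<close> entries differ, the pairs match crosswise, so
  \<open>x i\<close> is \<open>y (Suc i)\<close>.\<close>

lemma x_at_change:
  assumes "y i \<noteq> y (Suc i)"
  shows "x (Suc i) = sum_mset M - y i - y (Suc i)"
proof -
  have "{#x i, x (Suc i), y i#} = {#x (Suc i), x (Suc (Suc i)), y (Suc i)#}"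
    using triple[of i] triple[of "Suc i"] by simp
  then have "{#x i, y i#} = {#x (Suc (Suc i)), y (Suc i)#}"
    by (metis add_mset_commute add_mset_add_mset_same_iff)
  then have "x i = y (Suc i)" using assms by (auto simp: add_eq_conv_ex)
  then show ?thesis using sum_triple[of i] by simp
qed

text \<open>The difference x (i + n) - x i only changes sign from one index to the next, and it
  vanishes at a change of \<open>y\<close>, where the shared side is determined by the periodic
  \<open>y\<close>.\<close>

lemma x_periodic:
  assumes "y j \<noteq> y k"
  shows "x (i + n) = x i"
proof -
  obtain l where l: "y l \<noteq> y (Suc l)"
  proof -
    have "y l = y 0" if "\<And>l. y l = y (Suc l)" for l
      by (induction l) (use that in auto)
    then show ?thesis using that assms by metis
  qed
  have flip: "x (Suc i + n) - x (Suc i) = - (x (i + n) - x i)" for i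
    using sum_triple[of i] sum_triple[of "i + n"] y_periodic[of i] by simp
  have 0: "x (Suc l + n) - x (Suc l) = 0"
    using x_at_change[OF l] x_at_change[of "l + n"] l y_periodic[of l] y_periodic[of "Suc l"] by simp
  have abs: "\<bar>x (i + n) - x i\<bar> = \<bar>x n - x 0\<bar>" for i
  proof (induction i)
    case (Suc i)
    then show ?case using flip[of i] by simp
  qed simp
  have "\<bar>x n - x 0\<bar> = 0" using abs[of "Suc l"] 0 by simp
  then show ?thesis using abs[of i] by simp
qed

text \<open>Over half a turn every side at the vertex is counted by both of its adjacent sectors, which
  forces a parity on the number of sectors of each kind.\<close>

lemma steps_parity:
  assumes "y j \<noteq> y k"
  shows "steps z + 2 * card {i. i < n \<and> x i = z} = n * count M z"
proof -
  have card: "card {i. i < n \<and> f i = z} = (\<Sum>i<n. of_bool (f i = z))" for f :: "nat \<Rightarrow> real"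
    by (simp add: sum.If_cases of_bool_def Int_def)
  \<comment> \<open>The two sums differ only in the terms of \<open>x 0\<close> and
    \<open>x n\<close>, which agree because \<open>x\<close> is periodic.\<close>
  have "(\<Sum>i<n. of_bool (x (Suc i) = z)) + of_bool (x 0 = z)
      = (\<Sum>i<n. of_bool (x i = z)) + (of_bool (x n = z) :: nat)"
    using sum.lessThan_Suc[of "\<lambda>i. of_bool (x i = z) :: nat" n]
      sum.lessThan_Suc_shift[of "\<lambda>i. of_bool (x i = z) :: nat" n] by simp
  then have shift: "(\<Sum>i<n. of_bool (x (Suc i) = z)) = (\<Sum>i<n. of_bool (x i = z) :: nat)"
    using x_periodic[OF assms, of 0] by simp
  have cnt: "count M z = of_bool (x i = z) + of_bool (x (Suc i) = z) + of_bool (y i = z)" for i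
    by (subst triple[of i, symmetric]) simp
  have "n * count M z = (\<Sum>i<n. of_bool (x i = z) + of_bool (x (Suc i) = z) + of_bool (y i = z))"
    by (simp flip: cnt)
  also have "\<dots> = 2 * (\<Sum>i<n. of_bool (x i = z)) + (\<Sum>i<n. of_bool (y i = z))"
    by (simp add: sum.distrib shift)
  finally show ?thesis by (simp add: steps_def card)
qed

lemma steps_pos: "steps (y i) > 0"
proof -
  have "i mod n \<in> {k. k < n \<and> y k = y i}" using n_ge_2 by (simp add: y_mod)
  then show ?thesis unfolding steps_def by (subst card_gt_0_iff) auto
qed

lemma half_turn_steps: "(\<Sum>z\<in>set_mset M. steps z * g z) = pi"
proof -
  have "(\<Sum>i<n. g (y i)) = (\<Sum>z\<in>set_mset M. \<Sum>i\<in>{i \<in> {..<n}. y i = z}. g (y i))"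
    by (rule sum.group[symmetric]) (auto simp: y_in_M)
  also have "\<dots> = (\<Sum>z\<in>set_mset M. steps z * g z)"
    by (rule sum.cong) (auto simp: steps_def)
  finally show ?thesis using half_turn by simp
qed

lemma shape:
  obtains A where "M = {#A, A, A#}"
  | A C where "M = {#A, A, C#}" "A \<noteq> C"
  | A B C where "M = {#A, B, C#}" "A \<noteq> B" "A \<noteq> C" "B \<noteq> C"
proof -
  obtain A B C where M: "M = {#A, B, C#}" using triple[of 0] by metis
  consider "A = B \<and> B = C" | "A = B \<and> B \<noteq> C" | "A = C \<and> B \<noteq> C" | "B = C \<and> A \<noteq> C"
    | "A \<noteq> B \<and> A \<noteq> C \<and> B \<noteq> C" by blast
  then show ?thesis
  proof cases
    case 3
    then show ?thesis using that(2)[of A B] M by (simp add: add_mset_commute)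
  next
    case 4
    then show ?thesis using that(2)[of B A] M by (simp add: add_mset_commute)
  qed (use that M in auto)
qed

text \<open>Parity is played against the angle excess: a half turn has no room for all three angles
  of the triangle, since their sum exceeds \<open>pi\<close>.\<close>

lemma steps_ge_2:
  assumes "y j \<noteq> y k"
  shows "2 \<le> steps (y i)"
    and "\<exists>A B C. M = {#A, B, C#} \<and> A \<noteq> B \<and> A \<noteq> C \<and> B \<noteq> C"
proof -
  note par = steps_parity[OF assms]
  have "2 \<le> steps (y i) \<and> (\<exists>A B C. M = {#A, B, C#} \<and> A \<noteq> B \<and> A \<noteq> C \<and> B \<noteq> C)"
  proof (rule shape)
    fix A assume "M = {#A, A, A#}"
    then show ?thesis using y_in_M[of j] y_in_M[of k] assms by simp
  next
    fix A C assume M: "M = {#A, A, C#}" and AC: "A \<noteq> C"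
    have "{y j, y k} = {A, C}" using y_in_M[of j] y_in_M[of k] assms M by auto
    then have pos: "steps A > 0" "steps C > 0" using steps_pos by (metis insertI1 insertI2 insertE singletonD)+
    \<comment> \<open>\<open>A\<close> has multiplicity two, so \<open>steps A\<close> is even.
      Since both values occur, the half turn would contain two angles at \<open>A\<close> and one at
      \<open>C\<close>, the full angle sum.\<close>
    have "even (steps A + 2 * card {i. i < n \<and> x i = A})" unfolding par using M AC by simp
    then have "even (steps A)" by simp
    then have "steps A \<ge> 2" using pos by (auto elim!: evenE)
    then have "2 * g A \<le> steps A * g A" using g_pos[of A] M by simp
    moreover have "1 * g C \<le> steps C * g C" using pos g_pos[of C] M by (intro mult_right_mono) auto
    ultimately show ?thesis using half_turn_steps g_sum M AC by simp
  next
    fix A B C assume M: "M = {#A, B, C#}" and ne: "A \<noteq> B" "A \<noteq> C" "B \<noteq> C"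
    \<comment> \<open>Otherwise each of the three angles would fit into the half turn.\<close>
    have "\<exists>z\<in>#M. steps z = 0"
    proof (rule ccontr)
      assume "\<not> ?thesis"
      then have "1 * g z \<le> steps z * g z" if "z \<in># M" for z
        using g_pos[OF that] that by (intro mult_right_mono) (auto simp: Suc_le_eq)
      from this[of A] this[of B] this[of C] show False
        using half_turn_steps g_sum M ne by simp
    qed
    then obtain z where z: "z \<in># M" "steps z = 0" by blast
    have cnt: "count M w = 1" if "w \<in># M" for w using that M ne by auto
    \<comment> \<open>The missing value has multiplicity one, so its parity relation makes
      \<open>n\<close> even; then the count of every other value is even too.\<close>
    have "even n" using par[of z] cnt[OF z(1)] z(2) by (metis add_0 dvd_triv_left mult.right_neutral)
    then have "even (steps (y i) + 2 * card {k. k < n \<and> x k = y i})"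
      unfolding par by simp
    then have "even (steps (y i))" by simp
    then have "2 \<le> steps (y i)" using steps_pos[of i] by (auto elim!: evenE)
    then show ?thesis using M ne by blast
  qed
  then show "2 \<le> steps (y i)" "\<exists>A B C. M = {#A, B, C#} \<and> A \<noteq> B \<and> A \<noteq> C \<and> B \<noteq> C" by auto
qed

text \<open>An angle that occurs at the vertex occurs at least twice in a half turn:
  \<open>n\<close> times if \<open>y\<close> is constant, and by \<open>steps_ge_2\<close>
  otherwise.\<close>

lemma angle_le_half_pi: "g (y i) \<le> pi / 2"
proof (cases "\<forall>j. y j = y i")
  case True
  then have "(\<Sum>j<n. g (y j)) = (\<Sum>j<n. g (y i))"
    by (intro sum.cong refl arg_cong[of _ _ g]) blast
  then have "n * g (y i) = pi" using half_turn by simp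
  moreover have "2 * g (y i) \<le> n * g (y i)"
    using n_ge_2 g_pos[OF y_in_M] by (intro mult_right_mono) (auto intro: less_imp_le)
  ultimately show ?thesis by simp
next
  case False
  then obtain j where "y j \<noteq> y i" by blast
  then have "2 \<le> steps (y i)" by (rule steps_ge_2)
  then have "2 * g (y i) \<le> steps (y i) * g (y i)"
    using g_pos[OF y_in_M] by (intro mult_right_mono) (auto intro: less_imp_le)
  also have "\<dots> \<le> (\<Sum>z\<in>set_mset M. steps z * g z)"
    using g_pos by (intro member_le_sum) (auto simp: y_in_M less_imp_le)
  finally show ?thesis using half_turn_steps by simp
qed

text \<open>Two different angles, each occurring twice, have sum at most \<open>pi / 2\<close>, so
  the third would exceed \<open>pi / 2\<close>. The bound \<open>le\<close> ranges over all of
  \<open>M\<close>, because the third angle need not occur at this vertex.\<close>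

lemma y_constant:
  assumes le: "\<And>z. z \<in># M \<Longrightarrow> g z \<le> pi / 2"
  shows "y j = y k"
proof (rule ccontr)
  assume ne: "y j \<noteq> y k"
  obtain A B C where M: "M = {#A, B, C#}" "A \<noteq> B" "A \<noteq> C" "B \<noteq> C"
    using steps_ge_2[OF ne] by blast
  obtain Z where Z: "M = {#y j, y k, Z#}"
  proof -
    have "y j \<in> {A, B, C}" "y k \<in> {A, B, C}" using y_in_M M by auto
    then show ?thesis using that ne M by (auto simp: add_mset_commute)
  qed
  have "2 * g (y i) \<le> steps (y i) * g (y i)" for i
    using g_pos[OF y_in_M] steps_ge_2(1)[OF ne] by (intro mult_right_mono) (auto intro: less_imp_le)
  from this[of j] this[of k] have "2 * g (y j) + 2 * g (y k) \<le> (\<Sum>z\<in>{y j, y k}. steps z * g z)"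
    using ne by simp
  also have "\<dots> \<le> (\<Sum>z\<in>set_mset M. steps z * g z)"
    using g_pos by (intro sum_mono2) (auto simp: y_in_M less_imp_le)
  finally have "2 * g (y j) + 2 * g (y k) \<le> pi" using half_turn_steps by simp
  moreover have "g Z \<le> pi / 2" using le Z by simp
  ultimately show False using g_sum Z by simp
qed

end

section \<open>Spherical triangles\<close>

lemma triangle_corners_norm:
  assumes "triangle_corners a b c"
  shows "norm a = 1" "norm b = 1" "norm c = 1"
  using assms by (auto simp: triangle_corners_def)

lemma triangle_corners_commute:
  "triangle_corners a b c \<longleftrightarrow> triangle_corners b a c"
  "triangle_corners a b c \<longleftrightarrow> triangle_corners a c b"
  by (simp_all add: triangle_corners_def insert_commute)

lemma triangle_region_subset_commute:
  "triangle_region a b c \<subseteq> triangle_region b a c"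
  "triangle_region a b c \<subseteq> triangle_region a c b"
proof -
  have "s *\<^sub>R a + t *\<^sub>R b + u *\<^sub>R c = t *\<^sub>R b + s *\<^sub>R a + u *\<^sub>R c"
    "s *\<^sub>R a + t *\<^sub>R b + u *\<^sub>R c = s *\<^sub>R a + u *\<^sub>R c + t *\<^sub>R b" for s t u
    by (simp_all add: algebra_simps)
  then show "triangle_region a b c \<subseteq> triangle_region b a c"
    "triangle_region a b c \<subseteq> triangle_region a c b"
    unfolding triangle_region_def by blast+
qed

lemma triangle_region_commute:
  "triangle_region a b c = triangle_region b a c"
  "triangle_region a b c = triangle_region a c b"
  using triangle_region_subset_commute by blast+

lemma corner_in_triangle_region:
  assumes "triangle_corners a b c"
  shows "a \<in> triangle_region a b c"
proof -
  have "a = 1 *\<^sub>R a + 0 *\<^sub>R b + 0 *\<^sub>R c" by simp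
  then have "\<exists>s t u. s \<ge> 0 \<and> t \<ge> 0 \<and> u \<ge> 0 \<and> a = s *\<^sub>R a + t *\<^sub>R b + u *\<^sub>R c"
    by (metis order_refl zero_le_one)
  then show ?thesis
    unfolding triangle_region_def using triangle_corners_norm[OF assms] by simp
qed

lemma corners_in_triangle_region:
  assumes "triangle_corners a b c"
  shows "{a, b, c} \<subseteq> triangle_region a b c"
proof -
  have "b \<in> triangle_region b a c" "c \<in> triangle_region c a b"
    using assms triangle_corners_commute by (blast intro: corner_in_triangle_region)+
  then show ?thesis
    using corner_in_triangle_region[OF assms] triangle_region_commute by (metis empty_subsetI insert_subset)
qed

lemma triangle_corners_orthogonal_imp_0:
  assumes "triangle_corners a b c" "N \<bullet> a = 0" "N \<bullet> b = 0" "N \<bullet> c = 0"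
  shows "N = 0"
proof -
  have "span {a, b, c} = UNIV"
    using assms(1) dim_eq_full[of "{a, b, c}"] by (simp add: triangle_corners_def)
  then have "N \<in> span {a, b, c}" by simp
  moreover have "orthogonal N z" if "z \<in> {a, b, c}" for z
    using that assms by (auto simp: orthogonal_def)
  ultimately have "orthogonal N N" by (metis orthogonal_to_span)
  then show ?thesis by (simp add: orthogonal_self)
qed

text \<open>Since \<open>arccos\<close> is injective on [-1, 1], spherical distances determine inner
  products and thus Euclidean distances, and a distance-preserving map of the sphere extends
  linearly.\<close>

lemma sphere_isometry_orthogonal:
  assumes "sphere_isometry f"
  obtains h where "orthogonal_transformation h" "\<And>x. x \<in> sphere 0 1 \<Longrightarrow> h x = f x"
proof -
  have f1: "norm (f x) = 1" if "norm x = 1" for x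
    using assms that bij_betw_apply[of f "sphere 0 1" "sphere 0 1" x] by (simp add: sphere_isometry_def)
  have inner: "f x \<bullet> f y = x \<bullet> y" if "norm x = 1" "norm y = 1" for x y
  proof -
    have "arccos (f x \<bullet> f y) = arccos (x \<bullet> y)"
      using assms that by (simp add: sphere_isometry_def sphere_dist_def)
    moreover have "\<bar>f x \<bullet> f y\<bar> \<le> 1" "\<bar>x \<bullet> y\<bar> \<le> 1"
      using Cauchy_Schwarz_ineq2[of "f x" "f y"] Cauchy_Schwarz_ineq2[of x y] that f1 by simp_all
    ultimately show ?thesis by (simp add: arccos_eq_iff)
  qed
  have "dist (f x) (f y) = dist x y" if "norm x = 1" "norm y = 1" for x y
  proof -
    have "(dist (f x) (f y))\<^sup>2 = (dist x y)\<^sup>2"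
      using that f1 inner[OF that]
      by (simp add: dist_norm power2_norm_eq_inner inner_diff_left inner_diff_right inner_commute
          flip: dot_square_norm) (simp add: dot_square_norm inner_commute)
    then show ?thesis by (simp add: power2_eq_iff_nonneg)
  qed
  then show ?thesis using isometry_sphere_extend[of f] f1 that by auto
qed

lemma orthogonal_transformation_triangle:
  assumes h: "orthogonal_transformation h" and tri: "triangle_corners a b c"
  shows "triangle_corners (h a) (h b) (h c)"
    and "h ` triangle_region a b c = triangle_region (h a) (h b) (h c)"
proof -
  have lin: "linear h" and nrm: "\<And>x. norm (h x) = norm x"
    using h by (simp_all add: orthogonal_transformation_linear orthogonal_transformation_norm)
  have "dim (h ` {a, b, c}) = dim {a, b, c}"
    using lin orthogonal_transformation_inj[OF h] by (rule dim_image_eq[OF _ inj_on_subset]) simp_all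
  then show "triangle_corners (h a) (h b) (h c)"
    using tri nrm by (simp add: triangle_corners_def)
  have hcomb: "h (s *\<^sub>R a + t *\<^sub>R b + u *\<^sub>R c) = s *\<^sub>R h a + t *\<^sub>R h b + u *\<^sub>R h c" for s t u
    by (simp add: linear_add[OF lin] linear_scale[OF lin])
  show "h ` triangle_region a b c = triangle_region (h a) (h b) (h c)"
  proof
    show "h ` triangle_region a b c \<subseteq> triangle_region (h a) (h b) (h c)"
      unfolding triangle_region_def using hcomb nrm by fastforce
    show "triangle_region (h a) (h b) (h c) \<subseteq> h ` triangle_region a b c"
    proof
      fix y assume "y \<in> triangle_region (h a) (h b) (h c)"
      then obtain s t u where "s \<ge> 0" "t \<ge> 0" "u \<ge> 0" "norm y = 1"
          and y: "y = h (s *\<^sub>R a + t *\<^sub>R b + u *\<^sub>R c)"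
        unfolding triangle_region_def hcomb by auto
      then have "s *\<^sub>R a + t *\<^sub>R b + u *\<^sub>R c \<in> triangle_region a b c"
        unfolding triangle_region_def using nrm[of "s *\<^sub>R a + t *\<^sub>R b + u *\<^sub>R c"] by auto
      then show "y \<in> h ` triangle_region a b c" using y by blast
    qed
  qed
qed

text \<open>The linear extension of the isometry carries corners to corners, so congruence becomes
  equality of three inner products.\<close>

lemma sphere_congruent_triangle:
  assumes "sphere_congruent (triangle_region a b c) T" and tri: "triangle_corners a b c"
  obtains a' b' c' where "triangle_corners a' b' c'" "T = triangle_region a' b' c'"
    "a' \<bullet> b' = a \<bullet> b" "a' \<bullet> c' = a \<bullet> c" "b' \<bullet> c' = b \<bullet> c"
proof -
  obtain f where f: "sphere_isometry f" "f ` triangle_region a b c = T"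
    using assms(1) unfolding sphere_congruent_def by blast
  obtain h where h: "orthogonal_transformation h" and hf: "\<And>x. x \<in> sphere 0 1 \<Longrightarrow> h x = f x"
    using sphere_isometry_orthogonal[OF f(1)] by blast
  have "h ` triangle_region a b c = f ` triangle_region a b c"
    by (rule image_cong) (auto simp: hf triangle_region_def)
  then have "T = triangle_region (h a) (h b) (h c)"
    using orthogonal_transformation_triangle(2)[OF h tri] f(2) by simp
  then show ?thesis
    using that orthogonal_transformation_triangle(1)[OF h tri] h
    by (simp add: orthogonal_transformation_def)
qed

section \<open>Sides and angles of a spherical triangle\<close>

lemma triangle_side_bounds:
  assumes "triangle_corners a b c"
  shows "\<bar>a \<bullet> b\<bar> < 1"
proof -
  note n = triangle_corners_norm[OF assms]
  have "\<bar>a \<bullet> b\<bar> \<noteq> norm a * norm b"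
  proof
    assume "\<bar>a \<bullet> b\<bar> = norm a * norm b"
    then have "a = b \<or> a = - b" using n unfolding norm_cauchy_schwarz_abs_eq by auto
    then have "1 *\<^sub>R a + (-1) *\<^sub>R b + 0 *\<^sub>R c = 0 \<or> 1 *\<^sub>R a + 1 *\<^sub>R b + 0 *\<^sub>R c = 0" by auto
    then show False using assms dim3_indep(1) unfolding triangle_corners_def by fastforce
  qed
  then show ?thesis using Cauchy_Schwarz_ineq2[of a b] n by simp
qed

lemma triangle_gram_pos:
  assumes "triangle_corners a b c"
  shows "1 - (b \<bullet> c)\<^sup>2 - (a \<bullet> c)\<^sup>2 - (a \<bullet> b)\<^sup>2 + 2 * (b \<bullet> c) * (a \<bullet> c) * (a \<bullet> b) > 0"
proof -
  note n = triangle_corners_norm[OF assms]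
  have nn: "a \<bullet> a = 1" "b \<bullet> b = 1" "c \<bullet> c = 1" using n by (simp_all add: dot_square_norm)
  define p q r where "p = b \<bullet> c" "q = a \<bullet> c" "r = a \<bullet> b"
  note pqr = this
  have r: "1 - r\<^sup>2 > 0" using triangle_side_bounds[OF assms] by (simp add: pqr abs_square_less_1)
  \<comment> \<open>Up to the factor \<open>1 - r\<^sup>2\<close>, this is the component of
    \<open>c\<close> orthogonal to \<open>a\<close> and \<open>b\<close>; its squared length
    therefore contains the Gram determinant.\<close>
  define w where "w = (p * r - q) *\<^sub>R a + (q * r - p) *\<^sub>R b + (1 - r\<^sup>2) *\<^sub>R c"
  have "w \<noteq> 0"
  proof
    assume "w = 0"
    then have "1 - r\<^sup>2 = 0" using assms dim3_indep(3) unfolding triangle_corners_def w_def by blast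
    then show False using r by simp
  qed
  then have "w \<bullet> w > 0" by simp
  also have "w \<bullet> w = (1 - r\<^sup>2) * (1 - p\<^sup>2 - q\<^sup>2 - r\<^sup>2 + 2 * p * q * r)"
  proof -
    have comm: "c \<bullet> b = p" "b \<bullet> c = p" "c \<bullet> a = q" "a \<bullet> c = q" "b \<bullet> a = r" "a \<bullet> b = r"
      by (simp_all add: pqr inner_commute)
    show ?thesis
      unfolding w_def by (simp add: inner_add_left inner_add_right nn comm)
        (simp add: power2_eq_square algebra_simps)
  qed
  finally show ?thesis using r by (simp add: pqr zero_less_mult_iff)
qed

text \<open>The spherical law of cosines: the length of a tangent part is the sine of the
  side.\<close>

lemma corner_angle_eq_opposite_angle:
  assumes "triangle_corners v b c"
  shows "corner_angle v b c = opposite_angle {#v \<bullet> b, v \<bullet> c, b \<bullet> c#} (b \<bullet> c)"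
proof -
  have n: "v \<bullet> v = 1" "b \<bullet> b = 1" "c \<bullet> c = 1"
    using triangle_corners_norm[OF assms] by (simp_all add: dot_square_norm)
  have "norm (tangent_part v x) = sqrt (1 - (v \<bullet> x)\<^sup>2)" if "x \<bullet> x = 1" for x
    using that n by (simp add: norm_eq_sqrt_inner tangent_part_def inner_diff_left inner_diff_right
        inner_commute power2_eq_square)
  moreover have "tangent_part v b \<bullet> tangent_part v c = b \<bullet> c - (v \<bullet> b) * (v \<bullet> c)"
    using n by (simp add: tangent_part_def inner_diff_left inner_diff_right inner_commute)
  ultimately show ?thesis using n by (simp add: corner_angle_def opposite_angle_triple)
qed

text \<open>These are the metric inputs to \<open>triangle_pattern\<close>. Injectivity lets
  information about angles pass back to the opposite sides.\<close>

lemma opposite_angle_triangle: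
  assumes tri: "triangle_corners a b c" and M: "M = {#b \<bullet> c, a \<bullet> c, a \<bullet> b#}"
  shows "(\<Sum>z\<in>#M. opposite_angle M z) > pi"
    and "inj_on (opposite_angle M) (set_mset M)"
    and "\<And>z. z \<in># M \<Longrightarrow> opposite_angle M z > 0"
proof -
  define A B C where "A = b \<bullet> c" "B = a \<bullet> c" "C = a \<bullet> b"
  note ABC = this
  have A: "\<bar>A\<bar> < 1" and B: "\<bar>B\<bar> < 1" and C: "\<bar>C\<bar> < 1"
    unfolding ABC using tri triangle_corners_commute triangle_side_bounds by blast+
  have D: "1 - A\<^sup>2 - B\<^sup>2 - C\<^sup>2 + 2 * A * B * C > 0"
    using triangle_gram_pos[OF tri] by (simp add: ABC)
  have D': "1 - A\<^sup>2 - C\<^sup>2 - B\<^sup>2 + 2 * A * C * B > 0" "1 - B\<^sup>2 - C\<^sup>2 - A\<^sup>2 + 2 * B * C * A > 0"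
    "1 - B\<^sup>2 - A\<^sup>2 - C\<^sup>2 + 2 * B * A * C > 0" "1 - C\<^sup>2 - A\<^sup>2 - B\<^sup>2 + 2 * C * A * B > 0"
    using D by (simp_all add: algebra_simps)
  have M': "M = {#B, C, A#}" "M = {#A, C, B#}" "M = {#A, B, C#}" "M = {#C, B, A#}" "M = {#C, A, B#}"
    "M = {#B, A, C#}"
    by (simp_all add: M ABC add_mset_commute)
  have a: "opposite_angle M A = arccos ((A - B * C) / (sqrt (1 - B\<^sup>2) * sqrt (1 - C\<^sup>2)))"
    and b: "opposite_angle M B = arccos ((B - A * C) / (sqrt (1 - A\<^sup>2) * sqrt (1 - C\<^sup>2)))"
    and c: "opposite_angle M C = arccos ((C - A * B) / (sqrt (1 - A\<^sup>2) * sqrt (1 - B\<^sup>2)))"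
    by (subst M'(1), rule opposite_angle_triple, subst M'(2), rule opposite_angle_triple,
        subst M'(3), rule opposite_angle_triple)
  show "(\<Sum>z\<in>#M. opposite_angle M z) > pi"
    using angle_sum_gt_pi[OF A B C D] unfolding a[symmetric] b[symmetric] c[symmetric]
    by (subst (2) M'(3)) (simp add: add.assoc)
  have "A = B" if "opposite_angle M A = opposite_angle M B"
    using that by (rule opposite_angle_inj[OF A B C D, folded M'(1,2)])
  moreover have "A = C" if "opposite_angle M A = opposite_angle M C"
    using that by (rule opposite_angle_inj[OF A C B D'(1), folded M'(4,3)])
  moreover have "B = C" if "opposite_angle M B = opposite_angle M C"
    using that by (rule opposite_angle_inj[OF B C A D'(2), folded M'(5,6)])
  moreover have "set_mset M = {A, B, C}" by (auto simp: M'(3))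
  ultimately show "inj_on (opposite_angle M) (set_mset M)"
    unfolding inj_on_def by (metis insertE singletonD)
  have "opposite_angle M A > 0" unfolding a by (rule gram_det_trig[OF A B C refl D refl])
  moreover have "opposite_angle M B > 0" unfolding b by (rule gram_det_trig[OF B A C refl D'(3) refl])
  moreover have "opposite_angle M C > 0" unfolding c by (rule gram_det_trig[OF C A B refl D'(4) refl])
  ultimately show "opposite_angle M z > 0" if "z \<in># M" for z
    using that \<open>set_mset M = {A, B, C}\<close> by auto
qed

section \<open>Cells of an arrangement\<close>

text \<open>\<open>N\<close> selects a normal vector for each circle, so that the position of a
  point relative to the arrangement is a vector of signs.\<close>

locale great_circle_arrangement =
  fixes \<C> :: "(real ^ 3) set set" and N :: "(real ^ 3) set \<Rightarrow> real ^ 3"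
  assumes finite_circles: "finite \<C>"
    and nonempty: "\<C> \<noteq> {}"
    and normal_nonzero: "\<And>C. C \<in> \<C> \<Longrightarrow> N C \<noteq> 0"
    and circle_eq: "\<And>C. C \<in> \<C> \<Longrightarrow> C = {x \<in> sphere 0 1. N C \<bullet> x = 0}"
begin

definition generic :: "real ^ 3 \<Rightarrow> bool" where
  "generic x \<longleftrightarrow> (\<forall>C\<in>\<C>. N C \<bullet> x \<noteq> 0)"

definition cell :: "real ^ 3 \<Rightarrow> (real ^ 3) set" where
  "cell x = {y \<in> sphere 0 1. \<forall>C\<in>\<C>. 0 \<le> (N C \<bullet> x) * (N C \<bullet> y)}"

text \<open>Not restricted to the sphere, so that it is an intersection of open half-spaces and
  hence convex.\<close>

definition open_cone :: "real ^ 3 \<Rightarrow> (real ^ 3) set" where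
  "open_cone x = {y. \<forall>C\<in>\<C>. 0 < (N C \<bullet> x) * (N C \<bullet> y)}"

lemma complement_eq: "sphere 0 1 - \<Union>\<C> = {x \<in> sphere 0 1. generic x}"
  using circle_eq unfolding generic_def by blast

lemma zero_notin_open_cone: "0 \<notin> open_cone x"
  using nonempty by (auto simp: open_cone_def)

lemma sgn_in_open_cone:
  assumes "z \<in> open_cone x"
  shows "sgn z \<in> open_cone x \<inter> sphere 0 1"
proof -
  have "z \<noteq> 0" using assms zero_notin_open_cone by auto
  then have "0 < inverse (norm z) * ((N C \<bullet> x) * (N C \<bullet> z))" if "C \<in> \<C>" for C
    using assms that by (simp add: open_cone_def)
  then show ?thesis
    using \<open>z \<noteq> 0\<close> by (simp add: open_cone_def norm_sgn) (simp add: sgn_div_norm mult.left_commute)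
qed

lemma open_cone_sphere_subset_cell: "open_cone x \<inter> sphere 0 1 \<subseteq> cell x"
  by (auto simp: open_cone_def cell_def less_imp_le)

text \<open>The set is the radial projection of a convex cone that misses the origin.\<close>

lemma connected_open_cone_sphere: "connected (open_cone x \<inter> sphere 0 1)"
proof -
  have "open_cone x = (\<Inter>C\<in>\<C>. {y. ((N C \<bullet> x) *\<^sub>R N C) \<bullet> y > 0})"
    by (auto simp: open_cone_def)
  then have "convex (open_cone x)"
    by (auto intro!: convex_INT simp: convex_halfspace_gt simp del: inner_scaleR_left)
  then have "connected (sgn ` open_cone x)"
    using zero_notin_open_cone
    by (intro connected_continuous_image convex_connected continuous_on_sgn continuous_on_id) auto
  moreover have "sgn ` open_cone x = open_cone x \<inter> sphere 0 1"
  proof (intro equalityI subsetI)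
    fix y assume "y \<in> sgn ` open_cone x"
    then show "y \<in> open_cone x \<inter> sphere 0 1" using sgn_in_open_cone by blast
  next
    fix y assume "y \<in> open_cone x \<inter> sphere 0 1"
    then show "y \<in> sgn ` open_cone x" by (auto simp: sgn_div_norm intro!: image_eqI[of _ _ y])
  qed
  ultimately show ?thesis by simp
qed

text \<open>A linear functional without zeros on a connected set keeps its sign, which confines the
  component to the cone. Conversely, the spherical part of the cone is connected and avoids the
  circles.\<close>

lemma connected_component_eq:
  assumes x: "x \<in> sphere 0 1" "generic x"
  shows "connected_component_set (sphere 0 1 - \<Union>\<C>) x = open_cone x \<inter> sphere 0 1"
proof
  have "x \<in> open_cone x \<inter> sphere 0 1"
    using x by (auto simp: open_cone_def generic_def zero_less_mult_iff not_less order.order_iff_strict)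
  moreover have "open_cone x \<inter> sphere 0 1 \<subseteq> sphere 0 1 - \<Union>\<C>"
    unfolding complement_eq by (fastforce simp: open_cone_def generic_def)
  ultimately show "open_cone x \<inter> sphere 0 1 \<subseteq> connected_component_set (sphere 0 1 - \<Union>\<C>) x"
    using connected_open_cone_sphere by (intro connected_component_maximal)
  show "connected_component_set (sphere 0 1 - \<Union>\<C>) x \<subseteq> open_cone x \<inter> sphere 0 1"
  proof
    fix y assume y: "y \<in> connected_component_set (sphere 0 1 - \<Union>\<C>) x"
    define K where "K = connected_component_set (sphere 0 1 - \<Union>\<C>) x"
    have K: "connected K" "K \<subseteq> {x \<in> sphere 0 1. generic x}" "x \<in> K" "y \<in> K"
      using y x connected_component_subset[of "sphere 0 1 - \<Union>\<C>" x]
      by (auto simp: K_def complement_eq)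
    have "0 < (N C \<bullet> x) * (N C \<bullet> y)" if C: "C \<in> \<C>" for C
    proof -
      have con: "connected ((\<lambda>z. N C \<bullet> z) ` K)"
        by (intro connected_continuous_image K continuous_intros)
      have "0 \<notin> (\<lambda>z. N C \<bullet> z) ` K" using K(2) C by (auto simp: generic_def)
      moreover have "N C \<bullet> x \<in> (\<lambda>z. N C \<bullet> z) ` K" "N C \<bullet> y \<in> (\<lambda>z. N C \<bullet> z) ` K" using K by auto
      ultimately have "\<not> (N C \<bullet> x \<le> 0 \<and> 0 \<le> N C \<bullet> y)" "\<not> (N C \<bullet> y \<le> 0 \<and> 0 \<le> N C \<bullet> x)"
        using connectedD_interval[OF con] by blast+
      then show ?thesis by (auto simp: zero_less_mult_iff not_le)
    qed
    then show "y \<in> open_cone x \<inter> sphere 0 1" using K by (auto simp: open_cone_def)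
  qed
qed

lemma closure_open_cone_sphere:
  assumes x: "generic x"
  shows "closure (open_cone x \<inter> sphere 0 1) = cell x"
proof
  have "cell x = sphere 0 1 \<inter> (\<Inter>C\<in>\<C>. {y. ((N C \<bullet> x) *\<^sub>R N C) \<bullet> y \<ge> 0})"
    by (auto simp: cell_def)
  then have "closed (cell x)"
    by (auto intro!: closed_Int closed_INT simp: closed_halfspace_ge simp del: inner_scaleR_left)
  then show "closure (open_cone x \<inter> sphere 0 1) \<subseteq> cell x"
    by (intro closure_minimal open_cone_sphere_subset_cell)
  show "cell x \<subseteq> closure (open_cone x \<inter> sphere 0 1)"
  proof
    fix y assume y: "y \<in> cell x"
    \<comment> \<open>Any positive multiple of \<open>x\<close> added to \<open>y\<close> makes all
      the weak sign conditions strict, so \<open>y\<close> is a limit of points of the open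
      cell.\<close>
    define f where "f k = sgn (y + inverse (real (Suc k)) *\<^sub>R x)" for k
    have "f k \<in> open_cone x \<inter> sphere 0 1" for k
    proof -
      define z where "z = y + inverse (real (Suc k)) *\<^sub>R x"
      have "0 < (N C \<bullet> x) * (N C \<bullet> z)" if "C \<in> \<C>" for C
      proof -
        have "(N C \<bullet> x) * (N C \<bullet> z) = (N C \<bullet> x) * (N C \<bullet> y) + inverse (real (Suc k)) * (N C \<bullet> x)\<^sup>2"
          by (simp add: z_def inner_add_right algebra_simps power2_eq_square)
        also have "\<dots> > 0"
          using that x y by (intro add_nonneg_pos) (auto simp: cell_def generic_def simp del: of_nat_Suc)
        finally show ?thesis .
      qed
      then have "z \<in> open_cone x" by (simp add: open_cone_def)
      then show ?thesis unfolding f_def z_def[symmetric] by (rule sgn_in_open_cone)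
    qed
    moreover have "f \<longlonglongrightarrow> y"
    proof -
      have "norm y = 1" using y by (simp add: cell_def)
      have "(\<lambda>k. y + inverse (real (Suc k)) *\<^sub>R x) \<longlonglongrightarrow> y + 0 *\<^sub>R x"
        by (intro tendsto_intros LIMSEQ_inverse_real_of_nat)
      then have "f \<longlonglongrightarrow> sgn (y + 0 *\<^sub>R x)"
        unfolding f_def using \<open>norm y = 1\<close> by (intro tendsto_sgn) auto
      then show ?thesis using \<open>norm y = 1\<close> by (simp add: sgn_div_norm)
    qed
    ultimately show "y \<in> closure (open_cone x \<inter> sphere 0 1)"
      unfolding closure_sequential by blast
  qed
qed

lemma cell_sgn: "x \<noteq> 0 \<Longrightarrow> cell (sgn x) = cell x"
  by (simp add: cell_def sgn_div_norm mult.assoc)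
    (simp add: zero_le_mult_iff[of "inverse (norm x)"] not_le)

lemma generic_sgn: "x \<noteq> 0 \<Longrightarrow> generic (sgn x) \<longleftrightarrow> generic x"
  by (simp add: generic_def sgn_div_norm)

text \<open>Cells are labelled by arbitrary generic vectors, not only unit ones, since
  \<open>sgn\<close> moves a label to the sphere without changing its cell. Perturbed points can
  thus be labels as they are.\<close>

lemma cells_eq: "cells \<C> = cell ` {x. generic x}"
proof
  show "cells \<C> \<subseteq> cell ` {x. generic x}"
    unfolding cells_def components_def
    using connected_component_eq closure_open_cone_sphere by (auto simp: complement_eq)
  show "cell ` {x. generic x} \<subseteq> cells \<C>"
  proof
    fix T assume "T \<in> cell ` {x. generic x}"
    then obtain x where x: "generic x" "T = cell x" by blast
    then have "x \<noteq> 0" using nonempty by (auto simp: generic_def)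
    then have s: "generic (sgn x)" "T = cell (sgn x)" "sgn x \<in> sphere 0 1"
      using x by (simp_all add: cell_sgn generic_sgn norm_sgn)
    then show "T \<in> cells \<C>"
      unfolding cells_def components_def
      using connected_component_eq[of "sgn x"] closure_open_cone_sphere[of "sgn x"]
      by (auto simp: complement_eq image_iff)
  qed
qed

section \<open>Sides and corners of triangular cells\<close>

lemma normals_not_parallel:
  assumes "C \<in> \<C>" "D \<in> \<C>" "C \<noteq> D" "N C = k *\<^sub>R N D"
  shows False
proof -
  have "k \<noteq> 0" using assms normal_nonzero by auto
  then have "C = D" using circle_eq[OF assms(1)] circle_eq[OF assms(2)] assms(4) by simp
  then show False using assms by simp
qed

definition vertex :: "real ^ 3 \<Rightarrow> bool" where
  "vertex v \<longleftrightarrow> norm v = 1 \<and> (\<exists>C\<in>\<C>. \<exists>D\<in>\<C>. C \<noteq> D \<and> N C \<bullet> v = 0 \<and> N D \<bullet> v = 0)"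

text \<open>If no circle contained both ends, \<open>a + b\<close> would be strictly on the side of
  \<open>x\<close> for every circle and could be pushed slightly across the side, away from
  \<open>c\<close>, without leaving the cell. Its coefficient at \<open>c\<close> would then be
  negative.\<close>

lemma edge_on_circle:
  assumes x: "generic x" and T: "cell x = triangle_region a b c" and tri: "triangle_corners a b c"
  shows "\<exists>C\<in>\<C>. N C \<bullet> a = 0 \<and> N C \<bullet> b = 0"
proof (rule ccontr)
  assume none: "\<not> ?thesis"
  define h where "h C = (N C \<bullet> x) * (N C \<bullet> (a + b))" for C
  have in_cell: "a \<in> cell x" "b \<in> cell x" "c \<in> cell x"
    using corners_in_triangle_region[OF tri] T by auto
  have pos: "h C > 0" if "C \<in> \<C>" for C
  proof -
    have ge: "0 \<le> (N C \<bullet> x) * (N C \<bullet> a)" "0 \<le> (N C \<bullet> x) * (N C \<bullet> b)"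
      using in_cell that by (auto simp: cell_def)
    have "N C \<bullet> x \<noteq> 0" using x that by (simp add: generic_def)
    moreover have "N C \<bullet> a \<noteq> 0 \<or> N C \<bullet> b \<noteq> 0" using none that by blast
    ultimately have "(N C \<bullet> x) * (N C \<bullet> a) \<noteq> 0 \<or> (N C \<bullet> x) * (N C \<bullet> b) \<noteq> 0" by simp
    then have "0 < (N C \<bullet> x) * (N C \<bullet> a) + (N C \<bullet> x) * (N C \<bullet> b)" using ge by linarith
    then show ?thesis by (simp add: h_def inner_add_right distrib_left)
  qed
  \<comment> \<open>Each circle tolerates every sufficiently small positive \<open>e\<close>;
    finiteness yields one \<open>e\<close> for all circles.\<close>
  have "\<forall>\<^sub>F e in at_right 0. \<forall>C\<in>\<C>. 0 < h C - e * ((N C \<bullet> x) * (N C \<bullet> c))"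
  proof (rule eventually_ball_finite[OF finite_circles], rule ballI)
    fix C assume C: "C \<in> \<C>"
    have "((\<lambda>e. h C - e * ((N C \<bullet> x) * (N C \<bullet> c))) \<longlongrightarrow> h C - 0 * ((N C \<bullet> x) * (N C \<bullet> c))) (at_right 0)"
      by (intro tendsto_intros)
    then show "\<forall>\<^sub>F e in at_right 0. 0 < h C - e * ((N C \<bullet> x) * (N C \<bullet> c))"
      by (rule order_tendstoD) (simp add: pos[OF C])
  qed
  moreover have "\<forall>\<^sub>F e in at_right (0::real). 0 < e" by (simp add: eventually_at_right_less)
  ultimately have "\<forall>\<^sub>F e in at_right 0. 0 < e \<and> (\<forall>C\<in>\<C>. 0 < h C - e * ((N C \<bullet> x) * (N C \<bullet> c)))"
    by eventually_elim simp
  then obtain e where e: "0 < e" "\<And>C. C \<in> \<C> \<Longrightarrow> 0 < h C - e * ((N C \<bullet> x) * (N C \<bullet> c))"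
    by (auto dest: eventually_happens)
  define w where "w = a + b - e *\<^sub>R c"
  have "0 < (N C \<bullet> x) * (N C \<bullet> w)" if "C \<in> \<C>" for C
    using e(2)[OF that] by (simp add: w_def h_def inner_diff_right algebra_simps)
  then have "w \<in> open_cone x" by (simp add: open_cone_def)
  then have w0: "w \<noteq> 0" using zero_notin_open_cone by auto
  have "sgn w \<in> cell x"
    using \<open>w \<in> open_cone x\<close> sgn_in_open_cone open_cone_sphere_subset_cell by blast
  then obtain s t u where stu: "u \<ge> 0" "sgn w = s *\<^sub>R a + t *\<^sub>R b + u *\<^sub>R c"
    unfolding T triangle_region_def by blast
  have "w = norm w *\<^sub>R sgn w" using w0 by (simp add: sgn_div_norm)
  then have "a + b - e *\<^sub>R c = norm w *\<^sub>R (s *\<^sub>R a + t *\<^sub>R b + u *\<^sub>R c)"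
    unfolding stu(2) by (simp add: w_def)
  then have "(norm w * s - 1) *\<^sub>R a + (norm w * t - 1) *\<^sub>R b + (norm w * u + e) *\<^sub>R c = 0"
    by (simp add: algebra_simps)
  then have "norm w * u + e = 0" using tri dim3_indep(3) unfolding triangle_corners_def by blast
  moreover have "norm w * u \<ge> 0" using stu by simp
  ultimately show False using e(1) by linarith
qed

text \<open>The circles carrying the two sides at \<open>a\<close> are distinct, because a common
  normal would be orthogonal to all three corners.\<close>

lemma corner_vertex:
  assumes x: "generic x" and T: "cell x = triangle_region a b c" and tri: "triangle_corners a b c"
  shows "vertex a"
proof -
  obtain C where C: "C \<in> \<C>" "N C \<bullet> a = 0" "N C \<bullet> b = 0" using edge_on_circle[OF assms] by blast
  have T': "cell x = triangle_region a c b" and tri': "triangle_corners a c b"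
    using T tri triangle_region_commute(2) triangle_corners_commute(2) by blast+
  obtain D where D: "D \<in> \<C>" "N D \<bullet> a = 0" "N D \<bullet> c = 0"
    using edge_on_circle[OF x T' tri'] by blast
  have "C \<noteq> D" using C D triangle_corners_orthogonal_imp_0[OF tri] normal_nonzero by blast
  then show ?thesis using C D triangle_corners_norm[OF tri] unfolding vertex_def by blast
qed

text \<open>If two coefficients of \<open>v\<close> were nonzero, two distinct circles through
  \<open>v\<close> would both contain the corresponding two corners, and their normals would be
  parallel.\<close>

lemma vertex_in_cell:
  assumes x: "generic x" and T: "cell x = triangle_region a b c" and tri: "triangle_corners a b c"
    and v: "vertex v" "v \<in> cell x"
  shows "v \<in> {a, b, c}"
proof -
  obtain C D where CD: "C \<in> \<C>" "D \<in> \<C>" "C \<noteq> D" "N C \<bullet> v = 0" "N D \<bullet> v = 0"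
    using v unfolding vertex_def by blast
  obtain s t u where stu: "s \<ge> 0" "t \<ge> 0" "u \<ge> 0" and vv: "v = s *\<^sub>R a + t *\<^sub>R b + u *\<^sub>R c"
    using v(2) unfolding T triangle_region_def by blast
  have in_cell: "a \<in> cell x" "b \<in> cell x" "c \<in> cell x"
    using corners_in_triangle_region[OF tri] T by auto
  \<comment> \<open>The corners lie on the side of \<open>x\<close>, so the terms of the sum for
    \<open>v\<close> are nonnegative; when the sum is zero, each term is.\<close>
  have tight: "(s = 0 \<or> N C \<bullet> a = 0) \<and> (t = 0 \<or> N C \<bullet> b = 0) \<and> (u = 0 \<or> N C \<bullet> c = 0)"
    if "C \<in> \<C>" "N C \<bullet> v = 0" for C
  proof -
    define p where "p z = (N C \<bullet> x) * (N C \<bullet> z)" for z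
    have ge: "0 \<le> s * p a" "0 \<le> t * p b" "0 \<le> u * p c"
      using in_cell that stu by (auto simp: cell_def p_def)
    have "s * p a + t * p b + u * p c = (N C \<bullet> x) * (N C \<bullet> v)"
      by (simp add: p_def vv inner_add_right algebra_simps)
    then have "s * p a + t * p b + u * p c = 0" using that(2) by simp
    then have "s * p a = 0" "t * p b = 0" "u * p c = 0" using ge by linarith+
    moreover have "N C \<bullet> x \<noteq> 0" using x that by (simp add: generic_def)
    ultimately show ?thesis by (simp add: p_def)
  qed
  have parallel: False if "N C \<bullet> y = 0" "N C \<bullet> z = 0" "N D \<bullet> y = 0" "N D \<bullet> z = 0"
    "triangle_corners y z w" for y z w
  proof -
    \<comment> \<open>This combination of the normals is chosen to vanish on \<open>w\<close>; on
      \<open>y\<close> and \<open>z\<close> both normals vanish already.\<close>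
    have "((N D \<bullet> w) *\<^sub>R N C - (N C \<bullet> w) *\<^sub>R N D) = 0"
      using that(1-4) by (intro triangle_corners_orthogonal_imp_0[OF that(5)]) (simp_all add: inner_diff_left)
    moreover have "N D \<bullet> w \<noteq> 0"
      using triangle_corners_orthogonal_imp_0[OF that(5)] that normal_nonzero CD by blast
    ultimately have "N C = inverse (N D \<bullet> w) *\<^sub>R ((N C \<bullet> w) *\<^sub>R N D)"
      by (metis eq_iff_diff_eq_0 left_inverse scaleR_one scaleR_scaleR)
    then have "N C = (inverse (N D \<bullet> w) * (N C \<bullet> w)) *\<^sub>R N D" by simp
    then show False using normals_not_parallel CD by blast
  qed
  have tris: "triangle_corners a b c" "triangle_corners a c b" "triangle_corners b c a"
    using tri triangle_corners_commute by blast+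
  note tC = tight[OF CD(1,4)] and tD = tight[OF CD(2,5)]
  have "s = 0 \<or> t = 0" using tC tD parallel[OF _ _ _ _ tris(1)] by blast
  moreover have "s = 0 \<or> u = 0" using tC tD parallel[OF _ _ _ _ tris(2)] by blast
  moreover have "t = 0 \<or> u = 0" using tC tD parallel[OF _ _ _ _ tris(3)] by blast
  ultimately consider "t = 0" "u = 0" | "s = 0" "u = 0" | "s = 0" "t = 0" by blast
  moreover have "norm v = 1" using v(2) by (simp add: cell_def)
  ultimately show ?thesis
    using vv stu triangle_corners_norm[OF tri] by cases auto
qed

text \<open>The right-hand side does not mention the corners, so any two descriptions of a cell as a
  triangle have the same corner set.\<close>

lemma corner_set_unique:
  assumes x: "generic x" and T: "cell x = triangle_region a b c" and tri: "triangle_corners a b c"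
  shows "{a, b, c} = {v \<in> cell x. vertex v}"
proof -
  have "vertex a" "vertex b" "vertex c"
    using corner_vertex[OF x] T tri triangle_region_commute triangle_corners_commute by metis+
  moreover have "{a, b, c} \<subseteq> cell x" using corners_in_triangle_region[OF tri] T by simp
  ultimately show ?thesis using vertex_in_cell[OF assms] by blast
qed

end

section \<open>The sectors at a vertex\<close>

lemma orthonormal_frame_exists:
  fixes v :: "real ^ 3"
  assumes v: "norm v = 1"
  obtains e1 e2 where "norm e1 = 1" "norm e2 = 1" "v \<bullet> e1 = 0" "v \<bullet> e2 = 0" "e1 \<bullet> e2 = 0"
    "triangle_corners v e1 e2"
proof -
  obtain w where w: "w \<noteq> 0" "v \<bullet> w = 0"
    using orthogonal_to_vector_exists[of v] by (auto simp: orthogonal_def)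
  define e1 where "e1 = sgn w"
  define e2 where "e2 = cross3 v e1"
  have e1: "norm e1 = 1" "v \<bullet> e1 = 0" using w by (simp_all add: e1_def norm_sgn) (simp add: sgn_div_norm)
  have "(norm e2)\<^sup>2 = 1" using norm_cross_dot[of v e1] v e1 by (simp add: e2_def)
  then have e2: "norm e2 = 1" by (simp add: power2_eq_1_iff) (use norm_ge_zero[of e2] in linarith)
  have o: "v \<bullet> e2 = 0" "e1 \<bullet> e2 = 0"
    by (simp_all add: e2_def dot_cross_self)
  have ne: "v \<noteq> e1" "v \<noteq> e2" "e1 \<noteq> e2"
    using v e1 e2 o by (auto simp: dot_square_norm)
  have "independent {v, e1, e2}"
    using v e1 e2 o by (intro pairwise_orthogonal_independent)
      (auto simp: pairwise_def orthogonal_def inner_commute)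
  then have "dim {v, e1, e2} = 3" using ne by (subst dim_eq_card_independent) auto
  then have "triangle_corners v e1 e2" using v e1 e2 by (simp add: triangle_corners_def)
  then show ?thesis using that e1 e2 o by blast
qed

text \<open>For small \<open>e\<close> a nonzero \<open>p i\<close> dominates and keeps its sign,
  while for \<open>p i = 0\<close> the value is \<open>e * q i\<close>. Applied to normals, it moves
  a vertex off all circles into an adjacent cell.\<close>

lemma perturb_keeps_sign:
  fixes p q :: "'a \<Rightarrow> real"
  assumes "finite I" and nz: "\<And>i. i \<in> I \<Longrightarrow> p i \<noteq> 0 \<or> q i \<noteq> 0"
  obtains e where "0 < e" "\<And>i. i \<in> I \<Longrightarrow> p i + e * q i \<noteq> 0"
    "\<And>i. i \<in> I \<Longrightarrow> 0 \<le> (p i + e * q i) * p i"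
proof -
  have pos: "\<forall>\<^sub>F e in at_right (0::real). 0 < e" by (simp add: eventually_at_right_less)
  have "\<forall>\<^sub>F e in at_right 0. \<forall>i\<in>I. p i + e * q i \<noteq> 0 \<and> 0 \<le> (p i + e * q i) * p i"
  proof (rule eventually_ball_finite[OF \<open>finite I\<close>], rule ballI)
    fix i assume i: "i \<in> I"
    show "\<forall>\<^sub>F e in at_right 0. p i + e * q i \<noteq> 0 \<and> 0 \<le> (p i + e * q i) * p i"
    proof (cases "p i = 0")
      case True
      with nz[OF i] show ?thesis by (intro eventually_mono[OF pos]) simp
    next
      case False
      have "((\<lambda>e. (p i + e * q i) * p i) \<longlongrightarrow> (p i + 0 * q i) * p i) (at_right 0)"
        by (intro tendsto_intros)
      moreover have "0 < (p i + 0 * q i) * p i"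
        using False not_real_square_gt_zero[of "p i"]
        by (simp only: mult_zero_left add_0_right) blast
      ultimately have "\<forall>\<^sub>F e in at_right 0. 0 < (p i + e * q i) * p i" by (rule order_tendstoD(1))
      then show ?thesis by (rule eventually_mono) (metis less_irrefl less_imp_le mult_zero_left)
    qed
  qed
  from eventually_happens'[OF trivial_limit_at_right_real eventually_conj[OF pos this]] that
  show ?thesis by blast
qed

locale vertex_frame = great_circle_arrangement +
  fixes v e1 e2 :: "real ^ 3"
  assumes vertex_v: "vertex v"
    and frame: "norm e1 = 1" "norm e2 = 1" "v \<bullet> e1 = 0" "v \<bullet> e2 = 0" "e1 \<bullet> e2 = 0"
      "triangle_corners v e1 e2"
    and triangular: "\<And>x. generic x \<Longrightarrow> spherical_triangle (cell x)"
begin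

lemma norm_v: "norm v = 1"
  using vertex_v by (simp add: vertex_def)

lemma frame_expansion: "x = (v \<bullet> x) *\<^sub>R v + (e1 \<bullet> x) *\<^sub>R e1 + (e2 \<bullet> x) *\<^sub>R e2"
proof -
  have sq: "v \<bullet> v = 1" "e1 \<bullet> e1 = 1" "e2 \<bullet> e2 = 1" using frame norm_v by (simp_all add: dot_square_norm)
  have "x - ((v \<bullet> x) *\<^sub>R v + (e1 \<bullet> x) *\<^sub>R e1 + (e2 \<bullet> x) *\<^sub>R e2) = 0"
    using frame(3-5) sq
    by (intro triangle_corners_orthogonal_imp_0[OF frame(6)])
      (simp_all add: inner_diff_left inner_add_left inner_commute[of x] inner_commute[of e1 v]
        inner_commute[of e2 v] inner_commute[of e2 e1])
  then show ?thesis by simp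
qed

definition dir :: "real \<Rightarrow> real ^ 3" where
  "dir t = cos t *\<^sub>R e1 + sin t *\<^sub>R e2"

text \<open>Angles are not reduced modulo \<open>2 * pi\<close>: going around \<open>v\<close>
  becomes moving up the real line, and the set is invariant under shifts by
  \<open>pi\<close>.\<close>

definition circle_dirs :: "real set" where
  "circle_dirs = {t. \<exists>C\<in>\<C>. N C \<bullet> v = 0 \<and> N C \<bullet> dir t = 0}"

lemma dir_0: "dir 0 = e1" and dir_half_pi: "dir (pi / 2) = e2"
  by (simp_all add: dir_def)

lemma dir_plus_pi: "dir (t + pi) = - dir t"
  by (simp add: dir_def)

lemma dir_rotate: "dir t = cos (t - s) *\<^sub>R dir s + sin (t - s) *\<^sub>R dir (s + pi / 2)"
proof -
  have "dir t = dir ((t - s) + s)" by simp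
  then show ?thesis by (simp only: dir_def cos_add sin_add) (simp add: algebra_simps)
qed

lemma inner_dir: "dir s \<bullet> dir t = cos (t - s)"
proof -
  have "e1 \<bullet> e1 = 1" "e2 \<bullet> e2 = 1" using frame by (simp_all add: dot_square_norm)
  then show ?thesis
    using frame by (simp add: dir_def inner_add_left inner_add_right inner_commute cos_diff mult.commute)
qed

lemma norm_dir: "norm (dir t) = 1"
  using inner_dir[of t t] by (simp add: norm_eq_sqrt_inner)

text \<open>On the unit circle of the tangent plane a linear functional is a sinusoid, fixed up to a
  factor by one zero. The factor is nonzero, as otherwise the normal would vanish on the whole
  frame.\<close>

lemma normal_inner_dir:
  assumes "C \<in> \<C>" "N C \<bullet> v = 0" "N C \<bullet> dir s = 0"
  obtains R where "R \<noteq> 0" "\<And>t. N C \<bullet> dir t = R * sin (t - s)"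
proof -
  define R where "R = N C \<bullet> dir (s + pi / 2)"
  have eq: "N C \<bullet> dir t = R * sin (t - s)" for t
    by (subst dir_rotate[of t s]) (use assms in \<open>simp add: inner_add_right R_def\<close>)
  have "R \<noteq> 0"
  proof
    assume "R = 0"
    then have "N C \<bullet> e1 = 0" "N C \<bullet> e2 = 0" using eq[of 0] eq[of "pi / 2"] by (simp_all add: dir_0 dir_half_pi)
    then show False
      using triangle_corners_orthogonal_imp_0[OF frame(6) assms(2)] normal_nonzero[OF assms(1)] by simp
  qed
  then show ?thesis using that eq by blast
qed

text \<open>Polar coordinates with the angle in a prescribed window of length \<open>2 * pi\<close>;
  the freedom to choose \<open>m\<close> later controls the signs of sines.\<close>

lemma tangent_polar:
  assumes w: "v \<bullet> w = 0" "w \<noteq> 0"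
  obtains r t where "r > 0" "w = r *\<^sub>R dir t" "m - pi \<le> t" "t < m + pi"
proof -
  define p q where "p = (e1 \<bullet> w) * cos m + (e2 \<bullet> w) * sin m"
    and "q = (e2 \<bullet> w) * cos m - (e1 \<bullet> w) * sin m"
  have "w = (e1 \<bullet> w) *\<^sub>R dir 0 + (e2 \<bullet> w) *\<^sub>R dir (pi / 2)"
    using frame_expansion[of w] w by (simp add: dir_0 dir_half_pi)
  also have "\<dots> = p *\<^sub>R dir m + q *\<^sub>R dir (m + pi / 2)"
    by (subst dir_rotate[of 0 m], subst dir_rotate[of "pi / 2" m])
      (simp add: p_def q_def cos_diff sin_diff algebra_simps)
  finally have w_eq: "w = p *\<^sub>R dir m + q *\<^sub>R dir (m + pi / 2)" .
  define r where "r = sqrt (p\<^sup>2 + q\<^sup>2)"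
  have "p \<noteq> 0 \<or> q \<noteq> 0" using w_eq w by auto
  then have pos: "p\<^sup>2 + q\<^sup>2 > 0" by (simp add: sum_power2_gt_zero_iff)
  then have r: "r > 0" "r\<^sup>2 = p\<^sup>2 + q\<^sup>2" by (simp_all add: r_def)
  \<comment> \<open>The signs are reversed because \<open>u\<close> is measured from
    \<open>m - pi\<close> rather than from \<open>m\<close>.\<close>
  have "(- p / r)\<^sup>2 + (- q / r)\<^sup>2 = (p\<^sup>2 + q\<^sup>2) / r\<^sup>2"
    by (simp add: power_divide add_divide_distrib)
  also have "\<dots> = 1" using r(1) unfolding r(2)[symmetric] by simp
  finally have "(- p / r)\<^sup>2 + (- q / r)\<^sup>2 = 1" .
  then obtain u where u: "0 \<le> u" "u < 2 * pi" "- p / r = cos u" "- q / r = sin u"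
    using sincos_total_2pi by metis
  then have pq: "p = - r * cos u" "q = - r * sin u" using r by (auto simp: field_simps)
  have "w = r *\<^sub>R dir (m - pi + u)"
    unfolding w_eq pq by (subst dir_rotate[of _ m]) (simp add: cos_add sin_add cos_diff sin_diff algebra_simps)
  then show ?thesis using that[of r "m - pi + u"] r u by simp
qed

section \<open>Enumerating the directions of the circles through the vertex\<close>

lemma circle_dirs_plus_pi: "t + pi \<in> circle_dirs \<longleftrightarrow> t \<in> circle_dirs"
  by (simp add: circle_dirs_def dir_plus_pi)

lemma circle_dirs_minus_pi: "t - pi \<in> circle_dirs \<longleftrightarrow> t \<in> circle_dirs"
  using circle_dirs_plus_pi[of "t - pi"] by simp

lemma circle_dirs_nonempty: "circle_dirs \<noteq> {}"
proof -
  obtain C where C: "C \<in> \<C>" "N C \<bullet> v = 0" using vertex_v unfolding vertex_def by blast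
  then obtain r t where rt: "N C = r *\<^sub>R dir t"
    using tangent_polar[of "N C"] normal_nonzero[OF C(1)] by (metis inner_commute)
  have "N C \<bullet> dir (t + pi / 2) = 0" by (simp add: rt inner_dir)
  then show ?thesis using C unfolding circle_dirs_def by blast
qed

lemma finite_circle_dirs: "finite (circle_dirs \<inter> {p..q})"
proof -
  have fin: "finite {t \<in> {p..q}. N C \<bullet> dir t = 0}" if C: "C \<in> \<C>" "N C \<bullet> v = 0" for C
  proof (cases "\<exists>s. N C \<bullet> dir s = 0")
    case True
    then obtain s where s: "N C \<bullet> dir s = 0" by blast
    obtain R where R: "R \<noteq> 0" "\<And>t. N C \<bullet> dir t = R * sin (t - s)"
      using normal_inner_dir[OF C s] by blast
    have "{t \<in> {p..q}. N C \<bullet> dir t = 0} \<subseteq> (\<lambda>i. s + of_int i * pi) ` {\<lfloor>(p - s) / pi\<rfloor>..\<lceil>(q - s) / pi\<rceil>}"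
    proof
      fix t assume t: "t \<in> {t \<in> {p..q}. N C \<bullet> dir t = 0}"
      then have "sin (t - s) = 0" using R by simp
      then obtain i :: int where i: "t - s = of_int i * pi" using sin_zero_iff_int2 by blast
      then have "(p - s) / pi \<le> of_int i" "of_int i \<le> (q - s) / pi"
        using t by (auto simp: pos_divide_le_eq pos_le_divide_eq)
      then have "i \<in> {\<lfloor>(p - s) / pi\<rfloor>..\<lceil>(q - s) / pi\<rceil>}" by (simp add: floor_le_iff le_ceiling_iff)
      then show "t \<in> (\<lambda>i. s + of_int i * pi) ` {\<lfloor>(p - s) / pi\<rfloor>..\<lceil>(q - s) / pi\<rceil>}"
        using i by (intro image_eqI[of _ _ i]) auto
    qed
    then show ?thesis by (rule finite_subset) simp
  next
    case False
    then show ?thesis by simp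
  qed
  have "circle_dirs \<inter> {p..q} = (\<Union>C\<in>{C \<in> \<C>. N C \<bullet> v = 0}. {t \<in> {p..q}. N C \<bullet> dir t = 0})"
    by (auto simp: circle_dirs_def)
  then show ?thesis using finite_circles fin by simp
qed

text \<open>The window has length \<open>pi\<close> because it then contains \<open>t + pi\<close>,
  which belongs to \<open>circle_dirs\<close> whenever \<open>t\<close> does; so the minimum is over
  a nonempty set.\<close>

definition next_dir :: "real \<Rightarrow> real" where
  "next_dir t = Min (circle_dirs \<inter> {t<..t + pi})"

lemma next_dir:
  assumes t: "t \<in> circle_dirs"
  shows "next_dir t \<in> circle_dirs" "t < next_dir t" "next_dir t \<le> t + pi"
    "\<And>s. s \<in> circle_dirs \<Longrightarrow> t < s \<Longrightarrow> next_dir t \<le> s"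
proof -
  have fin: "finite (circle_dirs \<inter> {t<..t + pi})"
    by (rule finite_subset[OF _ finite_circle_dirs[of t "t + pi"]]) auto
  have mem: "t + pi \<in> circle_dirs \<inter> {t<..t + pi}" using t by (simp add: circle_dirs_plus_pi)
  then have "next_dir t \<in> circle_dirs \<inter> {t<..t + pi}"
    unfolding next_dir_def using fin by (intro Min_in) auto
  then show *: "next_dir t \<in> circle_dirs" "t < next_dir t" "next_dir t \<le> t + pi" by auto
  show "next_dir t \<le> s" if "s \<in> circle_dirs" "t < s" for s
  proof (cases "s \<le> t + pi")
    case True
    then show ?thesis unfolding next_dir_def using fin that by (intro Min_le) auto
  qed (use * in linarith)
qed

lemma next_dir_plus_pi:
  assumes t: "t \<in> circle_dirs"
  shows "next_dir (t + pi) = next_dir t + pi"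
proof (rule antisym)
  note n = next_dir[OF t]
  have t': "t + pi \<in> circle_dirs" using t by (simp add: circle_dirs_plus_pi)
  note n' = next_dir[OF t']
  show "next_dir (t + pi) \<le> next_dir t + pi" using n by (intro n') (simp_all add: circle_dirs_plus_pi)
  have "next_dir t \<le> next_dir (t + pi) - pi" using n' by (intro n) (simp_all add: circle_dirs_minus_pi)
  then show "next_dir t + pi \<le> next_dir (t + pi)" by simp
qed

definition first_dir :: real where
  "first_dir = (SOME t. t \<in> circle_dirs)"

definition nth_dir :: "nat \<Rightarrow> real" where
  "nth_dir i = (next_dir ^^ i) first_dir"

lemma nth_dir_Suc: "nth_dir (Suc i) = next_dir (nth_dir i)"
  by (simp add: nth_dir_def)

lemma nth_dir_mem: "nth_dir i \<in> circle_dirs"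
proof (induction i)
  case 0
  then show ?case using circle_dirs_nonempty by (simp add: nth_dir_def first_dir_def some_in_eq)
qed (simp add: nth_dir_Suc next_dir)

lemma strict_mono_nth_dir: "strict_mono nth_dir"
  unfolding strict_mono_Suc_iff nth_dir_Suc using next_dir(2)[OF nth_dir_mem] by blast

lemma nth_dir_unbounded: "\<exists>i. q < nth_dir i"
proof (rule ccontr)
  assume "\<not> ?thesis"
  then have "range nth_dir \<subseteq> circle_dirs \<inter> {nth_dir 0..q}"
    using nth_dir_mem strict_mono_leD[OF strict_mono_nth_dir] by (auto simp: not_less)
  then have "finite (range nth_dir)" using finite_circle_dirs finite_subset by blast
  then show False
    using strict_mono_imp_inj_on[OF strict_mono_nth_dir] finite_imageD by blast
qed

text \<open>The first index reaching \<open>nth_dir 0 + pi\<close> hits it exactly, since that value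
  is itself in \<open>circle_dirs\<close> and cannot be jumped over. Equivariance of
  \<open>next_dir\<close> propagates this to all \<open>i\<close>.\<close>

lemma nth_dir_half_turn:
  obtains n where "0 < n" "\<And>i. nth_dir (i + n) = nth_dir i + pi"
proof -
  define n where "n = (LEAST i. nth_dir 0 + pi \<le> nth_dir i)"
  have ex: "nth_dir 0 + pi \<le> nth_dir n"
    unfolding n_def using nth_dir_unbounded less_imp_le by (metis (mono_tags, lifting) LeastI)
  then have n0: "n > 0" using pi_gt_zero by (cases n) auto
  then obtain k where k: "n = Suc k" using gr0_implies_Suc by blast
  have "nth_dir k < nth_dir 0 + pi"
    using not_less_Least[of k "\<lambda>i. nth_dir 0 + pi \<le> nth_dir i"] k by (simp add: n_def)
  then have "nth_dir n \<le> nth_dir 0 + pi"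
    unfolding k nth_dir_Suc by (intro next_dir nth_dir_mem) (simp_all add: circle_dirs_plus_pi nth_dir_mem)
  then have 0: "nth_dir n = nth_dir 0 + pi" using ex by simp
  have "nth_dir (i + n) = nth_dir i + pi" for i
    by (induction i) (simp_all add: 0 nth_dir_Suc next_dir_plus_pi nth_dir_mem)
  then show ?thesis using that n0 by blast
qed

section \<open>Cells at the vertex as sectors between consecutive directions\<close>

lemma tangent_part_decomp: "x = (v \<bullet> x) *\<^sub>R v + tangent_part v x"
  by (simp add: tangent_part_def)

lemma inner_v_tangent_part: "v \<bullet> tangent_part v x = 0"
  using norm_v by (simp add: tangent_part_def inner_diff_right dot_square_norm)

lemma tangent_part_nonzero:
  assumes "triangle_corners v b c"
  shows "tangent_part v b \<noteq> 0"
proof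
  assume "tangent_part v b = 0"
  then have "(- (v \<bullet> b)) *\<^sub>R v + 1 *\<^sub>R b + 0 *\<^sub>R c = 0" by (simp add: tangent_part_def)
  then show False using assms dim3_indep(2) unfolding triangle_corners_def by fastforce
qed

lemma tangent_parts_independent:
  assumes tri: "triangle_corners v b c" and "p *\<^sub>R tangent_part v b + q *\<^sub>R tangent_part v c = 0"
  shows "p = 0"
proof -
  have "(- (p * (v \<bullet> b)) - q * (v \<bullet> c)) *\<^sub>R v + p *\<^sub>R b + q *\<^sub>R c = 0"
    using assms(2) by (simp add: tangent_part_def algebra_simps)
  then show ?thesis using tri dim3_indep(2) unfolding triangle_corners_def by blast
qed

lemma cell_at_vertex:
  assumes x: "generic x" and vx: "v \<in> cell x"
  obtains b c where "triangle_corners v b c" "cell x = triangle_region v b c"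
proof -
  obtain a b c where abc: "triangle_corners a b c" "cell x = triangle_region a b c"
    using triangular[OF x] unfolding spherical_triangle_def by blast
  then have "v \<in> {a, b, c}" using vertex_in_cell[OF x abc(2,1) vertex_v vx] by blast
  then show ?thesis
    using that abc triangle_corners_commute triangle_region_commute by (metis insertE singletonD)
qed

text \<open>Here \<open>m\<close> is the direction of an interior point and \<open>\<phi>\<close>
  that of a point \<open>z\<close> of the cell. The circles along \<open>s\<close> and
  \<open>s'\<close> keep \<open>\<phi>\<close> between them, and no other direction lies in the
  gap.\<close>

lemma cell_direction:
  assumes x: "x = p *\<^sub>R v + \<rho> *\<^sub>R dir m" "\<rho> > 0"
    and z: "z \<in> cell x" "tangent_part v z = r *\<^sub>R dir \<phi>" "r > 0"
    and \<phi>: "\<phi> \<in> circle_dirs" "m - pi \<le> \<phi>" "\<phi> < m + pi"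
    and s: "s \<in> circle_dirs" "s' \<in> circle_dirs" "s < m" "m < s'" "s' \<le> s + pi"
    and gap: "\<And>t. t \<in> circle_dirs \<Longrightarrow> s < t \<Longrightarrow> s' \<le> t"
  shows "\<phi> = s \<or> \<phi> = s'"
proof -
  \<comment> \<open>For the circle along \<open>t\<close>, the signed distances of \<open>x\<close>
    and \<open>z\<close> are nonzero multiples of these sines, with factors whose product is
    positive.\<close>
  have same_side: "0 \<le> sin (m - t) * sin (\<phi> - t)" if t: "t \<in> circle_dirs" for t
  proof -
    obtain D where D: "D \<in> \<C>" "N D \<bullet> v = 0" "N D \<bullet> dir t = 0"
      using t unfolding circle_dirs_def by blast
    obtain R where R: "R \<noteq> 0" "\<And>u. N D \<bullet> dir u = R * sin (u - t)"
      using normal_inner_dir[OF D] by blast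
    have nx: "N D \<bullet> x = \<rho> * (R * sin (m - t))" by (simp add: x inner_add_right D R)
    have "N D \<bullet> z = N D \<bullet> ((v \<bullet> z) *\<^sub>R v + tangent_part v z)" using tangent_part_decomp by metis
    then have nz: "N D \<bullet> z = r * (R * sin (\<phi> - t))" by (simp add: z inner_add_right D R)
    have "0 \<le> (N D \<bullet> x) * (N D \<bullet> z)" using z(1) D by (simp add: cell_def)
    also have "(N D \<bullet> x) * (N D \<bullet> z) = (\<rho> * r * R\<^sup>2) * (sin (m - t) * sin (\<phi> - t))"
      by (simp add: nx nz power2_eq_square)
    finally show ?thesis
      using mult_le_cancel_left_pos[of "\<rho> * r * R\<^sup>2" 0] x(2) z(3) R(1) by simp
  qed
  show ?thesis
  proof (cases "\<phi> < s'")
    case True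
    then have "\<phi> \<le> s" using gap \<phi>(1) by (meson not_le)
    moreover have "\<not> \<phi> < s"
    proof
      assume "\<phi> < s"
      then have "sin (s - \<phi>) > 0" using \<phi> s by (intro sin_gt_zero) auto
      then have "sin (\<phi> - s) < 0" using sin_minus[of "s - \<phi>"] by simp
      moreover have "sin (m - s) > 0" using s by (intro sin_gt_zero) auto
      ultimately show False using same_side[OF s(1)] by (simp add: zero_le_mult_iff)
    qed
    ultimately show ?thesis by simp
  next
    case False
    moreover have "\<not> s' < \<phi>"
    proof
      assume "s' < \<phi>"
      then have "sin (\<phi> - s') > 0" using \<phi> s by (intro sin_gt_zero) auto
      moreover have "sin (s' - m) > 0" using s by (intro sin_gt_zero) auto
      then have "sin (m - s') < 0" using sin_minus[of "s' - m"] by simp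
      ultimately show False using same_side[OF s(2)] by (simp add: zero_le_mult_iff)
    qed
    ultimately show ?thesis by simp
  qed
qed

definition sector :: "real \<Rightarrow> real \<Rightarrow> real ^ 3 \<Rightarrow> real ^ 3 \<Rightarrow> (real ^ 3) set \<Rightarrow> bool" where
  "sector s s' b c T \<longleftrightarrow> triangle_corners v b c \<and> T = triangle_region v b c \<and> T \<in> cells \<C> \<and>
     (\<exists>r r'. r > 0 \<and> r' > 0 \<and> tangent_part v b = r *\<^sub>R dir s \<and> tangent_part v c = r' *\<^sub>R dir s')"

text \<open>Both sides of the cell at \<open>v\<close> run along circles through \<open>v\<close>,
  so \<open>cell_direction\<close> allows only the two directions enclosing \<open>m\<close>.
  Independence of the tangent parts prevents both sides from using the same one.\<close>

lemma sector_exists: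
  assumes gx: "generic x" and vx: "v \<in> cell x"
    and x: "x = p *\<^sub>R v + \<rho> *\<^sub>R dir m" "\<rho> > 0"
    and s: "s \<in> circle_dirs" "s < m" "m < next_dir s"
  shows "\<exists>b c. sector s (next_dir s) b c (cell x)"
proof -
  note n = next_dir[OF s(1)]
  obtain b c where bc: "triangle_corners v b c" "cell x = triangle_region v b c"
    using cell_at_vertex[OF gx vx] by blast
  have cb: "triangle_corners v c b" "cell x = triangle_region v c b"
    using bc triangle_corners_commute(2) triangle_region_commute(2) by blast+
  have side: "\<exists>r \<phi>. r > 0 \<and> tangent_part v b = r *\<^sub>R dir \<phi> \<and> (\<phi> = s \<or> \<phi> = next_dir s)"
    if bc: "triangle_corners v b c" "cell x = triangle_region v b c" for b c
  proof -
    obtain r \<phi> where \<phi>: "r > 0" "tangent_part v b = r *\<^sub>R dir \<phi>" "m - pi \<le> \<phi>" "\<phi> < m + pi"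
      using tangent_polar[OF inner_v_tangent_part tangent_part_nonzero[OF bc(1)]] by blast
    obtain C where C: "C \<in> \<C>" "N C \<bullet> v = 0" "N C \<bullet> b = 0"
      using edge_on_circle[OF gx bc(2,1)] by blast
    then have "N C \<bullet> tangent_part v b = 0" by (simp add: tangent_part_def inner_diff_right)
    then have mem: "\<phi> \<in> circle_dirs" using C \<phi> unfolding circle_dirs_def by auto
    have "b \<in> cell x" using corners_in_triangle_region[OF bc(1)] bc(2) by simp
    then have "\<phi> = s \<or> \<phi> = next_dir s"
      using cell_direction[OF x _ \<phi>(2,1) mem \<phi>(3,4) s(1) n(1) s(2,3) n(3)] n(4) by blast
    then show ?thesis using \<phi> by blast
  qed
  obtain r \<phi> where \<phi>: "r > 0" "tangent_part v b = r *\<^sub>R dir \<phi>" "\<phi> = s \<or> \<phi> = next_dir s"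
    using side[OF bc] by blast
  obtain r' \<psi> where \<psi>: "r' > 0" "tangent_part v c = r' *\<^sub>R dir \<psi>" "\<psi> = s \<or> \<psi> = next_dir s"
    using side[OF cb] by blast
  have "\<phi> \<noteq> \<psi>"
  proof
    assume "\<phi> = \<psi>"
    then have "r' *\<^sub>R tangent_part v b + (- r) *\<^sub>R tangent_part v c = 0" using \<phi> \<psi> by simp
    then have "r' = 0" by (rule tangent_parts_independent[OF bc(1)])
    then show False using \<psi>(1) by simp
  qed
  then consider "\<phi> = s" "\<psi> = next_dir s" | "\<psi> = s" "\<phi> = next_dir s" using \<phi>(3) \<psi>(3) by blast
  moreover have "cell x \<in> cells \<C>" using gx cells_eq by blast
  ultimately show ?thesis
  proof cases
    case 1
    then have "sector s (next_dir s) b c (cell x)"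
      unfolding sector_def using \<phi>(1,2) \<psi>(1,2) bc \<open>cell x \<in> cells \<C>\<close> by blast
    then show ?thesis by blast
  next
    case 2
    then have "sector s (next_dir s) c b (cell x)"
      unfolding sector_def using \<phi>(1,2) \<psi>(1,2) cb \<open>cell x \<in> cells \<C>\<close> by blast
    then show ?thesis by blast
  qed
qed

text \<open>No circle has both \<open>v\<close> and \<open>dir m\<close> on it, which is what
  \<open>perturb_keeps_sign\<close> asks for when moving from \<open>v\<close> towards
  \<open>dir m\<close>.\<close>

lemma generic_point_near_vertex:
  assumes m: "m \<notin> circle_dirs"
  obtains x \<rho> where "generic x" "v \<in> cell x" "x = 1 *\<^sub>R v + \<rho> *\<^sub>R dir m" "\<rho> > 0"
proof -
  have nz: "N C \<bullet> v \<noteq> 0 \<or> N C \<bullet> dir m \<noteq> 0" if "C \<in> \<C>" for C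
    using m that unfolding circle_dirs_def by blast
  obtain e where e: "0 < e" "\<And>C. C \<in> \<C> \<Longrightarrow> N C \<bullet> v + e * (N C \<bullet> dir m) \<noteq> 0"
    "\<And>C. C \<in> \<C> \<Longrightarrow> 0 \<le> (N C \<bullet> v + e * (N C \<bullet> dir m)) * (N C \<bullet> v)"
    using perturb_keeps_sign[OF finite_circles, of "\<lambda>C. N C \<bullet> v" "\<lambda>C. N C \<bullet> dir m"] nz by blast
  define x where "x = 1 *\<^sub>R v + e *\<^sub>R dir m"
  have "N C \<bullet> x = N C \<bullet> v + e * (N C \<bullet> dir m)" for C
    by (simp only: x_def inner_add_right inner_scaleR_right mult_1)
  then have "generic x" "v \<in> cell x"
    unfolding generic_def cell_def using e(2,3) norm_v by simp_all
  then show ?thesis using that[of x e] e(1) x_def by blast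
qed

lemma sector_nth: "\<exists>b c T. sector (nth_dir i) (nth_dir (Suc i)) b c T"
proof -
  define s m where "s = nth_dir i" and "m = (s + next_dir s) / 2"
  have s: "s \<in> circle_dirs" by (simp add: s_def nth_dir_mem)
  note n = next_dir[OF s]
  have m: "s < m" "m < next_dir s" using n by (simp_all add: m_def)
  then have "m \<notin> circle_dirs" using n(4)[of m] by auto
  then obtain x \<rho> where x: "generic x" "v \<in> cell x" "x = 1 *\<^sub>R v + \<rho> *\<^sub>R dir m" "\<rho> > 0"
    using generic_point_near_vertex by blast
  show ?thesis
    using sector_exists[OF x s m] unfolding nth_dir_Suc s_def[symmetric] by blast
qed

text \<open>The direction of a label \<open>x\<close> of the cell falls strictly between two
  consecutive entries of \<open>nth_dir\<close>, and that gap determines the sector.\<close>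

lemma sector_of_cell:
  assumes T: "T \<in> cells \<C>" "v \<in> T"
  shows "\<exists>i b c. sector (nth_dir i) (nth_dir (Suc i)) b c T"
proof -
  obtain x where x: "generic x" "T = cell x" using T cells_eq by blast
  obtain C where C: "C \<in> \<C>" "N C \<bullet> v = 0" using vertex_v unfolding vertex_def by blast
  \<comment> \<open>A multiple of \<open>v\<close> would lie in the plane of any circle through
    \<open>v\<close> and not be generic.\<close>
  have "tangent_part v x \<noteq> 0"
  proof
    assume "tangent_part v x = 0"
    then have "x = (v \<bullet> x) *\<^sub>R v" by (simp add: tangent_part_def)
    then have "N C \<bullet> x = (v \<bullet> x) * (N C \<bullet> v)" by (metis inner_scaleR_right)
    then show False using x C by (simp add: generic_def)
  qed
  \<comment> \<open>Centring the window at \<open>nth_dir 0 + pi\<close> makes it start at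
    \<open>nth_dir 0\<close>, so the least index beyond \<open>m\<close> is a successor.\<close>
  then obtain \<rho> m where m: "\<rho> > 0" "tangent_part v x = \<rho> *\<^sub>R dir m" "nth_dir 0 + pi - pi \<le> m"
    using tangent_polar[OF inner_v_tangent_part, where m = "nth_dir 0 + pi"] by metis
  have xeq: "x = (v \<bullet> x) *\<^sub>R v + \<rho> *\<^sub>R dir m" using tangent_part_decomp[of x] m by simp
  define k where "k = (LEAST i. m < nth_dir i)"
  have k: "m < nth_dir k" unfolding k_def using nth_dir_unbounded by (rule LeastI_ex)
  then obtain i where i: "k = Suc i" using m(3) by (cases k) auto
  have "nth_dir i \<le> m"
    using not_less_Least[of i "\<lambda>i. m < nth_dir i"] i by (simp add: k_def not_less)
  moreover have "m \<notin> circle_dirs"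
  proof
    assume "m \<in> circle_dirs"
    then obtain D where "D \<in> \<C>" "N D \<bullet> v = 0" "N D \<bullet> dir m = 0" unfolding circle_dirs_def by blast
    then have "N D \<bullet> x = 0" by (subst xeq) (simp add: inner_add_right)
    then show False using x \<open>D \<in> \<C>\<close> by (simp add: generic_def)
  qed
  ultimately have lt: "nth_dir i < m" using nth_dir_mem[of i] by (cases "nth_dir i = m") auto
  have vx: "v \<in> cell x" and "m < next_dir (nth_dir i)" using T x k by (simp_all add: i nth_dir_Suc)
  then show ?thesis
    using sector_exists[OF x(1) vx xeq m(1) nth_dir_mem lt] unfolding x(2) nth_dir_Suc by blast
qed

lemma sector_angle:
  assumes S: "sector s s' b c T" and s: "s < s'" "s' \<le> s + pi"
  shows "corner_angle v b c = s' - s" "s' < s + pi" "has_angle_at T v (s' - s)"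
proof -
  obtain r r' where r: "r > 0" "r' > 0" "tangent_part v b = r *\<^sub>R dir s" "tangent_part v c = r' *\<^sub>R dir s'"
    and tri: "triangle_corners v b c" "T = triangle_region v b c"
    using S unfolding sector_def by blast
  show angle: "corner_angle v b c = s' - s"
    using r s by (simp add: corner_angle_def norm_dir inner_dir arccos_cos)
  \<comment> \<open>Opposite directions would make the two tangent parts linearly dependent.\<close>
  have "s' \<noteq> s + pi"
  proof
    assume "s' = s + pi"
    then have "r' *\<^sub>R tangent_part v b + r *\<^sub>R tangent_part v c = 0" using r by (simp add: dir_plus_pi)
    then have "r' = 0" by (rule tangent_parts_independent[OF tri(1)])
    then show False using r by simp
  qed
  then show "s' < s + pi" using s by simp
  show "has_angle_at T v (s' - s)" unfolding has_angle_at_def using tri angle by metis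
qed

text \<open>A circle through one end of a side which misses \<open>v\<close> cannot cross the side, so two cells
  that share a direction at \<open>v\<close> share the whole side.\<close>

lemma side_not_crossed:
  assumes x: "generic x" "cell x = triangle_region v b c" "triangle_corners v b c"
    and x': "generic x'" "cell x' = triangle_region v b' c'" "triangle_corners v b' c'"
    and b': "b' = k *\<^sub>R v + l *\<^sub>R b" "l \<ge> 0"
  shows "k \<le> 0"
proof (rule ccontr)
  assume "\<not> ?thesis"
  then have k: "k > 0" by simp
  have t: "triangle_corners b' c' v" "cell x' = triangle_region b' c' v"
    using x' triangle_corners_commute triangle_region_commute by metis+
  obtain C where C: "C \<in> \<C>" "N C \<bullet> b' = 0" "N C \<bullet> c' = 0"
    using edge_on_circle[OF x'(1) t(2,1)] by blast
  have "N C \<bullet> v \<noteq> 0"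
    using triangle_corners_orthogonal_imp_0[OF t(1)] C normal_nonzero by blast
  moreover have "N C \<bullet> x \<noteq> 0" using x C by (simp add: generic_def)
  moreover have "0 \<le> (N C \<bullet> x) * (N C \<bullet> v)" "0 \<le> (N C \<bullet> x) * (N C \<bullet> b)"
    using corners_in_triangle_region[OF x(3)] x(2) C by (auto simp: cell_def)
  ultimately have "0 < k * ((N C \<bullet> x) * (N C \<bullet> v))" "0 \<le> l * ((N C \<bullet> x) * (N C \<bullet> b))"
    using k b' by (simp_all add: order.strict_iff_order)
  then have "0 < (N C \<bullet> x) * (N C \<bullet> b')" by (simp add: b' inner_add_right algebra_simps)
  then show False using C by simp
qed

text \<open>Writing each far corner in terms of \<open>v\<close> and the other one,
  \<open>side_not_crossed\<close> in both directions gives opposite inequalities. So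
  \<open>b'\<close> is a positive multiple of the unit vector \<open>b\<close>.\<close>

lemma side_unique:
  assumes "triangle_corners v b c" "triangle_region v b c \<in> cells \<C>"
    and "triangle_corners v b' c'" "triangle_region v b' c' \<in> cells \<C>"
    and r: "r > 0" "tangent_part v b = r *\<^sub>R dir t" and r': "r' > 0" "tangent_part v b' = r' *\<^sub>R dir t"
  shows "b = b'"
proof -
  obtain x where x: "generic x" "cell x = triangle_region v b c" using assms(2) cells_eq by auto
  obtain x' where x': "generic x'" "cell x' = triangle_region v b' c'" using assms(4) cells_eq by auto
  define p p' where "p = v \<bullet> b" and "p' = v \<bullet> b'"
  have b: "b = p *\<^sub>R v + r *\<^sub>R dir t" and b': "b' = p' *\<^sub>R v + r' *\<^sub>R dir t"
    using tangent_part_decomp[of b] tangent_part_decomp[of b'] r r' by (simp_all add: p_def p'_def)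
  have e: "b' = (p' - r' / r * p) *\<^sub>R v + (r' / r) *\<^sub>R b" "b = (p - r / r' * p') *\<^sub>R v + (r / r') *\<^sub>R b'"
    using r(1) r'(1) unfolding b b' by (simp_all add: scaleR_diff_left scaleR_add_right)
  have le: "p' - r' / r * p \<le> 0" "p - r / r' * p' \<le> 0"
    using side_not_crossed[OF x assms(1) x' assms(3) e(1)] side_not_crossed[OF x' assms(3) x assms(1) e(2)]
      r(1) r'(1) by simp_all
  have "p' * r \<le> p * r'" "p * r' \<le> p' * r" using le r(1) r'(1) by (simp_all add: field_simps)
  then have "p' - r' / r * p = 0" using r(1) by (simp add: field_simps)
  then have bb: "b' = (r' / r) *\<^sub>R b" using e(1) by simp
  then have "norm b' = (r' / r) * norm b" using r(1) r'(1) by simp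
  then have "r' / r = 1" using triangle_corners_norm[OF assms(1)] triangle_corners_norm[OF assms(3)] by simp
  then show ?thesis using bb by simp
qed

lemma adjacent_sectors:
  assumes "sector s s' b c T" "sector s' s'' b' c' T'"
  shows "c = b'"
proof -
  obtain r where r: "r > 0" "tangent_part v c = r *\<^sub>R dir s'"
    using assms(1) unfolding sector_def by blast
  have 1: "triangle_corners v c b" "triangle_region v c b \<in> cells \<C>"
    using assms(1) triangle_corners_commute(2)[of v b c] triangle_region_commute(2)[of v b c]
    unfolding sector_def by auto
  obtain r' where r': "r' > 0" "tangent_part v b' = r' *\<^sub>R dir s'"
    using assms(2) unfolding sector_def by blast
  have 2: "triangle_corners v b' c'" "triangle_region v b' c' \<in> cells \<C>"
    using assms(2) unfolding sector_def by auto
  show ?thesis using side_unique[OF 1 2 r r'] .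
qed

end

section \<open>Arrangements with congruent cells\<close>

locale congruent_arrangement = great_circle_arrangement +
  fixes a b c :: "real ^ 3" and M :: "real multiset"
  assumes reference: "triangle_corners a b c" "triangle_region a b c \<in> cells \<C>"
    and M_def: "M = {#b \<bullet> c, a \<bullet> c, a \<bullet> b#}"
    and congruent: "\<And>T. T \<in> cells \<C> \<Longrightarrow> sphere_congruent (triangle_region a b c) T"
begin

text \<open>The image of the reference corners and the given corners are the same set by
  \<open>corner_set_unique\<close>; a permutation of the corners does not change the multiset of
  sides.\<close>

lemma sides_of_cell:
  assumes T: "triangle_corners p q r" "triangle_region p q r \<in> cells \<C>"
  shows "{#p \<bullet> q, p \<bullet> r, q \<bullet> r#} = M"
proof -
  obtain x where x: "generic x" "cell x = triangle_region p q r" using T cells_eq by auto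
  obtain a' b' c' where t: "triangle_corners a' b' c'" "triangle_region p q r = triangle_region a' b' c'"
    "a' \<bullet> b' = a \<bullet> b" "a' \<bullet> c' = a \<bullet> c" "b' \<bullet> c' = b \<bullet> c"
    using sphere_congruent_triangle[OF congruent[OF T(2)] reference(1)] by metis
  have set: "{a', b', c'} = {p, q, r}"
    using corner_set_unique[OF x T(1)] corner_set_unique[OF x(1) _ t(1)] x t by simp
  have "card {p, q, r} = 3"
    using T(1) dim_le_card'[of "{p, q, r}"] card_insert_le_m1[of 3 "{q, r}" p] card_insert_le_m1[of 2 "{r}" q]
    unfolding triangle_corners_def by (simp add: card_insert_if split: if_splits)
  then have "p \<noteq> q" "p \<noteq> r" "q \<noteq> r" by (auto simp: card_insert_if split: if_splits)
  then consider "p = a'" "q = b'" "r = c'" | "p = a'" "q = c'" "r = b'" | "p = b'" "q = a'" "r = c'"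
    | "p = b'" "q = c'" "r = a'" | "p = c'" "q = a'" "r = b'" | "p = c'" "q = b'" "r = a'"
    using set by (metis insertE insertI1 insertI2 singletonD)
  then show ?thesis
    unfolding M_def t(3-5)[symmetric] by cases (simp_all add: inner_commute add_mset_commute)
qed

text \<open>The angle of a sector is the difference of consecutive directions, so periodicity and
  the sum over a half turn come from \<open>nth_dir\<close>.\<close>

lemma vertex_pattern:
  assumes v: "vertex v"
  shows "\<exists>n x y. triangle_pattern M (opposite_angle M) n x y \<and>
    (\<forall>T\<in>cells \<C>. v \<in> T \<longrightarrow> (\<exists>i. has_angle_at T v (opposite_angle M (y i))))"
proof -
  have "norm v = 1" using v by (simp add: vertex_def)
  then obtain e1 e2 where frame: "norm e1 = 1" "norm e2 = 1" "v \<bullet> e1 = 0" "v \<bullet> e2 = 0" "e1 \<bullet> e2 = 0"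
    "triangle_corners v e1 e2" using orthonormal_frame_exists by blast
  interpret vertex_frame \<C> N v e1 e2
  proof unfold_locales
    fix x assume "generic x"
    then have "cell x \<in> cells \<C>" using cells_eq by blast
    from sphere_congruent_triangle[OF congruent[OF this] reference(1)]
    show "spherical_triangle (cell x)" unfolding spherical_triangle_def by metis
  qed (fact v frame)+
  note angle = opposite_angle_triangle[OF reference(1) M_def]
  obtain n where n: "0 < n" "\<And>i. nth_dir (i + n) = nth_dir i + pi" using nth_dir_half_turn by blast
  obtain B C S where S: "\<And>i. sector (nth_dir i) (nth_dir (Suc i)) (B i) (C i) (S i)"
    using sector_nth by metis
  \<comment> \<open>Adjacent sectors share a corner, so one sequence \<open>B\<close> describes both
    sides of every sector.\<close>
  have CB: "C i = B (Suc i)" for i using adjacent_sectors[OF S[of i] S[of "Suc i"]] .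
  define x y where "x i = v \<bullet> B i" and "y i = B i \<bullet> B (Suc i)" for i
  have step: "nth_dir i < nth_dir (Suc i)" "nth_dir (Suc i) \<le> nth_dir i + pi" for i
    using next_dir[OF nth_dir_mem] by (simp_all add: nth_dir_Suc)
  have sides: "{#v \<bullet> b, v \<bullet> c, b \<bullet> c#} = M" if "sector s s' b c T" for s s' b c T
    using that sides_of_cell unfolding sector_def by blast
  have opp: "corner_angle v b c = opposite_angle M (b \<bullet> c)" if "sector s s' b c T" for s s' b c T
    using that corner_angle_eq_opposite_angle[of v b c] sides[OF that] unfolding sector_def by metis
  have triple: "{#x i, x (Suc i), y i#} = M" for i
    using sides[OF S[of i]] by (simp add: x_def y_def CB)
  have y_mem: "y i \<in># M" for i unfolding triple[of i, symmetric] by simp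
  have ang: "opposite_angle M (y i) = nth_dir (Suc i) - nth_dir i" for i
    using opp[OF S[of i]] sector_angle(1)[OF S step] by (simp add: y_def CB)
  \<comment> \<open>A single sector filling the half turn would have angle
    \<open>pi\<close>.\<close>
  have "n \<noteq> 1" using sector_angle(2)[OF S[of 0] step] n(2)[of 0] by auto
  have "triangle_pattern M (opposite_angle M) n x y"
  proof
    show "0 < opposite_angle M z" if "z \<in># M" for z using angle(3) that .
    show "pi < (\<Sum>z\<in>#M. opposite_angle M z)" by (fact angle(1))
    show "2 \<le> n" using n(1) \<open>n \<noteq> 1\<close> by simp
    show "{#x i, x (Suc i), y i#} = M" for i by (fact triple)
    \<comment> \<open>Opposite sectors have equal angles; injectivity of the angle as a function of
      the side transfers this to \<open>y\<close>.\<close>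
    show "y (i + n) = y i" for i
    proof (rule inj_onD[OF angle(2)])
      show "opposite_angle M (y (i + n)) = opposite_angle M (y i)"
        using n(2)[of i] n(2)[of "Suc i"] by (simp add: ang)
    qed (fact y_mem)+
    show "(\<Sum>i<n. opposite_angle M (y i)) = pi"
      using n(2)[of 0] by (simp add: ang sum_lessThan_telescope)
  qed
  moreover have "\<exists>i. has_angle_at T v (opposite_angle M (y i))" if T: "T \<in> cells \<C>" "v \<in> T" for T
  proof -
    obtain i b c where "sector (nth_dir i) (nth_dir (Suc i)) b c T" using sector_of_cell[OF T] by blast
    then have "has_angle_at T v (opposite_angle M (y i))"
      unfolding ang using step by (rule sector_angle(3))
    then show ?thesis ..
  qed
  ultimately show ?thesis by blast
qed

text \<open>Every side of the reference triangle is opposite to one of its corners, and that corner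
  is a vertex of the arrangement. Its angle therefore occurs in the pattern there, and the local
  bound applies.\<close>

lemma angle_le_half_pi:
  assumes z: "z \<in># M"
  shows "opposite_angle M z \<le> pi / 2"
proof -
  have "\<exists>w. vertex w \<and> w \<in> triangle_region a b c \<and> has_angle_at (triangle_region a b c) w (opposite_angle M z)"
  proof -
    have *: ?thesis if "triangle_corners p q r" "triangle_region p q r = triangle_region a b c" "z = q \<bullet> r" for p q r
    proof -
      obtain x where x: "generic x" "cell x = triangle_region a b c" using reference cells_eq by auto
      have "vertex p" using corner_vertex[OF x(1) _ that(1)] that x by simp
      moreover have "p \<in> triangle_region a b c"
        using corner_in_triangle_region[OF that(1)] that by simp
      moreover have "corner_angle p q r = opposite_angle M z"
        using corner_angle_eq_opposite_angle[OF that(1)] sides_of_cell[OF that(1)] that reference by simp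
      ultimately show ?thesis using that(1,2) unfolding has_angle_at_def by metis
    qed
    have "triangle_corners b a c" "triangle_corners c a b"
      "triangle_region b a c = triangle_region a b c" "triangle_region c a b = triangle_region a b c"
      using reference triangle_corners_commute triangle_region_commute by metis+
    then show ?thesis using z *[of a b c] *[of b a c] *[of c a b] reference by (auto simp: M_def)
  qed
  then obtain w where w: "vertex w" "w \<in> triangle_region a b c"
    "has_angle_at (triangle_region a b c) w (opposite_angle M z)" by blast
  obtain n x y where pat: "triangle_pattern M (opposite_angle M) n x y"
    and cov: "\<forall>T\<in>cells \<C>. w \<in> T \<longrightarrow> (\<exists>i. has_angle_at T w (opposite_angle M (y i)))"
    using vertex_pattern[OF w(1)] by blast
  obtain i where "has_angle_at (triangle_region a b c) w (opposite_angle M (y i))"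
    using cov reference w by blast
  then have "opposite_angle M z = opposite_angle M (y i)" using has_angle_at_unique w(3) by blast
  then show ?thesis using triangle_pattern.angle_le_half_pi[OF pat] by simp
qed

lemma equal_angles_at_vertex:
  assumes v: "vertex v"
  shows "\<exists>\<alpha>. \<forall>T\<in>cells \<C>. v \<in> T \<longrightarrow> has_angle_at T v \<alpha>"
proof -
  obtain n x y where pat: "triangle_pattern M (opposite_angle M) n x y"
    and cov: "\<forall>T\<in>cells \<C>. v \<in> T \<longrightarrow> (\<exists>i. has_angle_at T v (opposite_angle M (y i)))"
    using vertex_pattern[OF v] by blast
  have "y i = y 0" for i
    using triangle_pattern.y_constant[OF pat angle_le_half_pi] by blast
  then show ?thesis using cov by metis
qed

end

theorem theorem3p1:
  fixes \<C> :: "(real ^ 3) set set" and v :: "real ^ 3"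
  assumes "finite \<C>"
    and "\<forall>C \<in> \<C>. great_circle C"
    and "\<forall>T \<in> cells \<C>. spherical_triangle T"
    and "\<forall>S \<in> cells \<C>. \<forall>T \<in> cells \<C>. sphere_congruent S T"
    and "\<exists>C \<in> \<C>. \<exists>D \<in> \<C>. C \<noteq> D \<and> v \<in> C \<and> v \<in> D"
  shows "\<exists>\<alpha>. \<forall>T \<in> cells \<C>. v \<in> T \<longrightarrow> has_angle_at T v \<alpha>"
\<comment> \<open>In the second case some cell is available as the reference triangle.\<close>
proof (cases "cells \<C> = {}")
  case True
  then show ?thesis by simp
next
  case False
  obtain N where N: "\<And>C. C \<in> \<C> \<Longrightarrow> N C \<noteq> 0 \<and> C = {x \<in> sphere 0 1. N C \<bullet> x = 0}"
    using assms(2) unfolding great_circle_def by metis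
  interpret great_circle_arrangement \<C> N
    using assms(1,5) N by unfold_locales blast+
  obtain C D where CD: "C \<in> \<C>" "D \<in> \<C>" "C \<noteq> D" "v \<in> C" "v \<in> D" using assms(5) by blast
  then have "N C \<bullet> v = 0" "N D \<bullet> v = 0" "norm v = 1" using circle_eq by auto
  then have "vertex v" using CD unfolding vertex_def by blast
  obtain T0 where T0: "T0 \<in> cells \<C>" using False by blast
  then obtain a b c where abc: "triangle_corners a b c" "T0 = triangle_region a b c"
    using assms(3) unfolding spherical_triangle_def by blast
  interpret congruent_arrangement \<C> N a b c "{#b \<bullet> c, a \<bullet> c, a \<bullet> b#}"
    using abc T0 assms(4) by unfold_locales auto
  show ?thesis using equal_angles_at_vertex[OF \<open>vertex v\<close>] .
qed

end
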